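(* Let $R$ be a unital ring and let $\Omega$ be a class of left $R$-modules such that: 1. $\Omega$ is closed under finite direct sums. 2. $\Omega$ is closed under direct summands. 3. Every indecomposable $N\in\Omega$ is strongly indecomposable. Then, if $M$ is a Krull-Schmidt artinian left $R$-module, there exists a direct sum decomposition $M=A\oplus B$ of $M$, unique up to decomposition-isomorphisms, such that $A\in\Omega$ and such that $B$ has no non-trivial (i.e. nonzero) direct summands in $\Omega$.
   Context: A module $M$ is called Krull-Schmidt artinian if the set $\mathcal{S}(M)$ of all direct summands of $M$, partially ordered by inclusion, satisfies the descending chain condition (equivalently, the ascending chain condition). A class $\Omega$ of modules is closed under finite direct sums if every module isomorphic to $N_1\oplus\dots\oplus N_k$ with $k\geq 0$ and $N_1,\dots,N_k\in\Omega$ belongs to $\Omega$; in particular $0\in\Omega$ and $\Omega$ is closed under isomorphism. A module is strongly indecomposable if its endomorphism ring is local. Two direct sum decompositions $M=\bigoplus_{\alpha\in A}M_\alpha$ and $M=\bigoplus_{\beta\in B}N_\beta$ are decomposition-isomorphic if there is a bijection $\phi:A\to B$ such that $M_\alpha\cong N_{\phi(\alpha)}$ for every $\alpha\in A$. In the decomposition $M=A\oplus B$ of the theorem the modules $A$ or $B$ may be zero. *)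

theory Defs
  imports "HOL-Algebra.Module" "HOL-Algebra.AbelCoset"
begin

text \<open>
  The library locale \<^locale>\<open>module\<close> demands a commutative ring of scalars. The following is the same
  locale over an arbitrary unital ring; it keeps the record type of \<^locale>\<open>module\<close>, so that
  \<^locale>\<open>submodule\<close> applies to it. The record fields of the multiplication and unit of the
  module are not used.
\<close>

locale left_module = R?: ring R + M?: abelian_group M for R (structure) and M (structure) +
  assumes smult_closed [simp, intro]:
      "\<lbrakk>a \<in> carrier R; x \<in> carrier M\<rbrakk> \<Longrightarrow> a \<odot>\<^bsub>M\<^esub> x \<in> carrier M"
    and smult_l_distr:
      "\<lbrakk>a \<in> carrier R; b \<in> carrier R; x \<in> carrier M\<rbrakk> \<Longrightarrow>
        (a \<oplus> b) \<odot>\<^bsub>M\<^esub> x = a \<odot>\<^bsub>M\<^esub> x \<oplus>\<^bsub>M\<^esub> b \<odot>\<^bsub>M\<^esub> x"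
    and smult_r_distr:
      "\<lbrakk>a \<in> carrier R; x \<in> carrier M; y \<in> carrier M\<rbrakk> \<Longrightarrow>
        a \<odot>\<^bsub>M\<^esub> (x \<oplus>\<^bsub>M\<^esub> y) = a \<odot>\<^bsub>M\<^esub> x \<oplus>\<^bsub>M\<^esub> a \<odot>\<^bsub>M\<^esub> y"
    and smult_assoc1:
      "\<lbrakk>a \<in> carrier R; b \<in> carrier R; x \<in> carrier M\<rbrakk> \<Longrightarrow>
        (a \<otimes> b) \<odot>\<^bsub>M\<^esub> x = a \<odot>\<^bsub>M\<^esub> (b \<odot>\<^bsub>M\<^esub> x)"
    and smult_one [simp]:
      "x \<in> carrier M \<Longrightarrow> \<one> \<odot>\<^bsub>M\<^esub> x = x"


subsection \<open>Homomorphisms and direct sums\<close>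

definition lmod_hom ::
  "('r, 'c) ring_scheme \<Rightarrow> ('r, 'a, 'd) module_scheme \<Rightarrow> ('r, 'b, 'e) module_scheme \<Rightarrow> ('a \<Rightarrow> 'b) set"
  where "lmod_hom R M N =
    {f \<in> carrier M \<rightarrow> carrier N.
       (\<forall>x \<in> carrier M. \<forall>y \<in> carrier M. f (x \<oplus>\<^bsub>M\<^esub> y) = f x \<oplus>\<^bsub>N\<^esub> f y) \<and>
       (\<forall>a \<in> carrier R. \<forall>x \<in> carrier M. f (a \<odot>\<^bsub>M\<^esub> x) = a \<odot>\<^bsub>N\<^esub> f x)}"

definition lmod_isomorphic ::
  "('r, 'c) ring_scheme \<Rightarrow> ('r, 'a, 'd) module_scheme \<Rightarrow> ('r, 'b, 'e) module_scheme \<Rightarrow> bool"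
  where "lmod_isomorphic R M N \<longleftrightarrow> (\<exists>f \<in> lmod_hom R M N. bij_betw f (carrier M) (carrier N))"

text \<open>External direct sum \<open>N 0 \<oplus> \<dots> \<oplus> N (k - 1)\<close>, the zero module for \<open>k = 0\<close>.\<close>

definition external_direct_sum :: "nat \<Rightarrow> (nat \<Rightarrow> ('r, 'a) module) \<Rightarrow> ('r, nat \<Rightarrow> 'a) module"
  where "external_direct_sum k N =
    \<lparr>carrier = (\<Pi>\<^sub>E i\<in>{..<k}. carrier (N i)),
     mult = undefined,
     one = undefined,
     zero = (\<lambda>i\<in>{..<k}. \<zero>\<^bsub>N i\<^esub>),
     add = (\<lambda>x y. \<lambda>i\<in>{..<k}. x i \<oplus>\<^bsub>N i\<^esub> y i),
     smult = (\<lambda>a x. \<lambda>i\<in>{..<k}. a \<odot>\<^bsub>N i\<^esub> x i)\<rparr>"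

text \<open>Internal decomposition \<open>M = A \<oplus> B\<close>, where \<open>A\<close> and \<open>B\<close> may be zero.\<close>

definition internal_direct_sum ::
  "('r, 'c) ring_scheme \<Rightarrow> ('r, 'a, 'd) module_scheme \<Rightarrow> 'a set \<Rightarrow> 'a set \<Rightarrow> bool"
  where "internal_direct_sum R M A B \<longleftrightarrow>
    submodule A R M \<and> submodule B R M \<and> A <+>\<^bsub>M\<^esub> B = carrier M \<and> A \<inter> B = {\<zero>\<^bsub>M\<^esub>}"

definition direct_summands ::
  "('r, 'c) ring_scheme \<Rightarrow> ('r, 'a, 'd) module_scheme \<Rightarrow> 'a set set"
  where "direct_summands R M = {A. \<exists>B. internal_direct_sum R M A B}"

text \<open>
  Two decompositions, given as families of modules indexed by \<open>I\<close> and \<open>J\<close>, are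
  decomposition-isomorphic if their terms are pairwise isomorphic up to reindexing.
\<close>

definition decomposition_isomorphic ::
  "('r, 'c) ring_scheme \<Rightarrow> 'i set \<Rightarrow> ('i \<Rightarrow> ('r, 'a, 'd) module_scheme) \<Rightarrow>
    'j set \<Rightarrow> ('j \<Rightarrow> ('r, 'b, 'e) module_scheme) \<Rightarrow> bool"
  where "decomposition_isomorphic R I M J N \<longleftrightarrow>
    (\<exists>\<phi>. bij_betw \<phi> I J \<and> (\<forall>i\<in>I. lmod_isomorphic R (M i) (N (\<phi> i))))"


subsection \<open>Chain condition and indecomposability\<close>

definition krull_schmidt_artinian ::
  "('r, 'c) ring_scheme \<Rightarrow> ('r, 'a, 'd) module_scheme \<Rightarrow> bool"
  where "krull_schmidt_artinian R M \<longleftrightarrow>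
    (\<forall>X :: nat \<Rightarrow> 'a set.
       (\<forall>n. X n \<in> direct_summands R M) \<and> (\<forall>n. X (Suc n) \<subseteq> X n) \<longrightarrow>
       (\<exists>n. \<forall>m\<ge>n. X m = X n))"

definition indecomposable ::
  "('r, 'c) ring_scheme \<Rightarrow> ('r, 'a, 'd) module_scheme \<Rightarrow> bool"
  where "indecomposable R M \<longleftrightarrow>
    carrier M \<noteq> {\<zero>\<^bsub>M\<^esub>} \<and>
    (\<forall>A B. internal_direct_sum R M A B \<longrightarrow> A = {\<zero>\<^bsub>M\<^esub>} \<or> B = {\<zero>\<^bsub>M\<^esub>})"

text \<open>
  Endomorphisms are cut off outside the carrier, so that equality in the ring is equality of maps.
\<close>

definition endomorphism_ring ::
  "('r, 'c) ring_scheme \<Rightarrow> ('r, 'a, 'd) module_scheme \<Rightarrow> ('a \<Rightarrow> 'a) ring"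
  where "endomorphism_ring R M =
    \<lparr>carrier = lmod_hom R M M \<inter> extensional (carrier M),
     mult = compose (carrier M),
     one = (\<lambda>x\<in>carrier M. x),
     zero = (\<lambda>x\<in>carrier M. \<zero>\<^bsub>M\<^esub>),
     add = (\<lambda>f g. \<lambda>x\<in>carrier M. f x \<oplus>\<^bsub>M\<^esub> g x)\<rparr>"

definition left_ideal :: "'a set \<Rightarrow> ('a, 'c) ring_scheme \<Rightarrow> bool"
  where "left_ideal I S \<longleftrightarrow>
    additive_subgroup I S \<and> (\<forall>a \<in> carrier S. \<forall>x \<in> I. a \<otimes>\<^bsub>S\<^esub> x \<in> I)"

definition maximal_left_ideal :: "'a set \<Rightarrow> ('a, 'c) ring_scheme \<Rightarrow> bool"
  where "maximal_left_ideal I S \<longleftrightarrow>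
    left_ideal I S \<and> I \<noteq> carrier S \<and>
    (\<forall>J. left_ideal J S \<and> I \<subseteq> J \<longrightarrow> J = I \<or> J = carrier S)"

text \<open>A noncommutative ring is local if it has exactly one maximal left ideal.\<close>

definition local_ring :: "('a, 'c) ring_scheme \<Rightarrow> bool"
  where "local_ring S \<longleftrightarrow> ring S \<and> (\<exists>!I. maximal_left_ideal I S)"

definition strongly_indecomposable ::
  "('r, 'c) ring_scheme \<Rightarrow> ('r, 'a, 'd) module_scheme \<Rightarrow> bool"
  where "strongly_indecomposable R M \<longleftrightarrow> local_ring (endomorphism_ring R M)"


subsection \<open>Closure properties of classes of modules\<close>

text \<open>
  A class of modules is a set of modules whose elements live in one arbitrary type \<open>'a\<close>. The external
  direct sum itself lives in another type, but closure concerns all modules isomorphic to it.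
\<close>

definition closed_under_finite_direct_sums ::
  "('r, 'c) ring_scheme \<Rightarrow> ('r, 'a) module set \<Rightarrow> bool"
  where "closed_under_finite_direct_sums R \<Omega> \<longleftrightarrow>
    (\<forall>k N P. (\<forall>i<k. N i \<in> \<Omega>) \<and> left_module R P \<and>
       lmod_isomorphic R P (external_direct_sum k N) \<longrightarrow> P \<in> \<Omega>)"

definition closed_under_direct_summands ::
  "('r, 'c) ring_scheme \<Rightarrow> ('r, 'a) module set \<Rightarrow> bool"
  where "closed_under_direct_summands R \<Omega> \<longleftrightarrow>
    (\<forall>N \<in> \<Omega>. \<forall>A \<in> direct_summands R N. N\<lparr>carrier := A\<rparr> \<in> \<Omega>)"


subsection \<open>Decompositions relative to a class\<close>

definition class_decomposition ::
  "('r, 'c) ring_scheme \<Rightarrow> ('r, 'a) module set \<Rightarrow> ('r, 'a) module \<Rightarrow> 'a set \<Rightarrow> 'a set \<Rightarrow> bool"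
  where "class_decomposition R \<Omega> M A B \<longleftrightarrow>
    internal_direct_sum R M A B \<and>
    M\<lparr>carrier := A\<rparr> \<in> \<Omega> \<and>
    (\<forall>C \<in> direct_summands R (M\<lparr>carrier := B\<rparr>). M\<lparr>carrier := C\<rparr> \<in> \<Omega> \<longrightarrow> C = {\<zero>\<^bsub>M\<^esub>})"

end

theory Submission
  imports Defs
begin

text \<open>
  Existence. Among the complements \<open>B\<close> of direct summands of \<open>M\<close> that lie in \<open>\<Omega>\<close>, the chain condition
  provides a minimal one. If such a \<open>B\<close> had a nonzero direct summand \<open>C \<in> \<Omega>\<close>, then \<open>C\<close> could be moved
  to the other side, since \<open>\<Omega>\<close> is closed under direct sums, and \<open>B\<close> would shrink.

  Uniqueness. Let \<open>M = A \<oplus> B = A' \<oplus> B'\<close> be two decompositions as in the theorem. The main point is that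
  \<open>A\<close> can be exchanged into the second one (lemma \<open>exchange\<close>): there are direct summands \<open>C\<close> of \<open>A'\<close> and
  \<open>D\<close> of \<open>B'\<close> with \<open>M = A \<oplus> C \<oplus> D\<close>. Write \<open>A' = C \<oplus> C'\<close> and \<open>B' = D \<oplus> D'\<close>. Both \<open>A\<close> and \<open>C' \<oplus> D'\<close> are
  complements of \<open>C \<oplus> D\<close>, hence they are isomorphic, so \<open>D'\<close> is in \<open>\<Omega>\<close>; being a direct summand of \<open>B'\<close>, it
  is zero. Now \<open>B\<close> and \<open>C \<oplus> B'\<close> are both complements of \<open>A\<close>, hence isomorphic, so \<open>B\<close> has a direct summand
  isomorphic to \<open>C \<in> \<Omega>\<close>, and \<open>C = 0\<close>. What is left is \<open>M = A \<oplus> B'\<close>, and comparing this with each of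
  the two given decompositions yields \<open>B \<cong> B'\<close> and \<open>A \<cong> A'\<close>.

  The exchange. Consider \<open>M = X \<oplus> C \<oplus> D\<close> with \<open>X \<subseteq> A\<close>, \<open>C\<close> a direct summand of \<open>A'\<close> and \<open>D\<close> one of \<open>B'\<close>, such
  that \<open>C \<oplus> D\<close> is minimal. If \<open>X \<noteq> A\<close>, the chain condition provides an indecomposable direct summand
  \<open>E\<close> of \<open>M\<close> inside \<open>A\<close> that is independent of \<open>X\<close>, together with a projection \<open>p\<close> of \<open>M\<close> onto \<open>E\<close> that
  kills \<open>X\<close>. On \<open>E\<close> the identity is the sum of the two maps \<open>E \<rightarrow> C \<rightarrow> E\<close> and \<open>E \<rightarrow> D \<rightarrow> E\<close>, where the second
  arrows are restrictions of \<open>p\<close>. The endomorphism ring of \<open>E\<close> is local, so one of them has a left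
  inverse, and then \<open>E\<close> can replace a part of \<open>C\<close> or of \<open>D\<close> (lemma \<open>exchange_step\<close>), against minimality.
  This replaces the usual decomposition of \<open>A\<close> into finitely many strongly indecomposable modules
  and the induction over them.
\<close>

section \<open>Submodules and internal direct sums\<close>

context left_module
begin

lemma smult_r_null:
  assumes "a \<in> carrier R"
  shows "a \<odot>\<^bsub>M\<^esub> \<zero>\<^bsub>M\<^esub> = \<zero>\<^bsub>M\<^esub>"
proof -
  have "a \<odot>\<^bsub>M\<^esub> \<zero>\<^bsub>M\<^esub> \<oplus>\<^bsub>M\<^esub> a \<odot>\<^bsub>M\<^esub> \<zero>\<^bsub>M\<^esub> = a \<odot>\<^bsub>M\<^esub> \<zero>\<^bsub>M\<^esub>"
    using smult_r_distr[OF assms M.zero_closed M.zero_closed] by simp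
  then show ?thesis
    using assms by (metis M.add.r_cancel_one' M.zero_closed smult_closed)
qed

lemma submoduleI:
  assumes "H \<subseteq> carrier M" "\<zero>\<^bsub>M\<^esub> \<in> H"
    and "\<And>x. x \<in> H \<Longrightarrow> \<ominus>\<^bsub>M\<^esub> x \<in> H"
    and "\<And>x y. x \<in> H \<Longrightarrow> y \<in> H \<Longrightarrow> x \<oplus>\<^bsub>M\<^esub> y \<in> H"
    and "\<And>a x. a \<in> carrier R \<Longrightarrow> x \<in> H \<Longrightarrow> a \<odot>\<^bsub>M\<^esub> x \<in> H"
  shows "submodule H R M"
  apply (intro submodule.intro subgroup.intro)
  using assms unfolding submodule_axioms_def by (simp_all add: a_inv_def)

lemma submoduleD:
  assumes "submodule H R M"
  shows "H \<subseteq> carrier M"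
    and "x \<in> H \<Longrightarrow> x \<in> carrier M"
    and "\<zero>\<^bsub>M\<^esub> \<in> H"
    and "x \<in> H \<Longrightarrow> \<ominus>\<^bsub>M\<^esub> x \<in> H"
    and "x \<in> H \<Longrightarrow> y \<in> H \<Longrightarrow> x \<oplus>\<^bsub>M\<^esub> y \<in> H"
    and "a \<in> carrier R \<Longrightarrow> x \<in> H \<Longrightarrow> a \<odot>\<^bsub>M\<^esub> x \<in> H"
proof -
  interpret H: submodule H R M by fact
  show "H \<subseteq> carrier M" "x \<in> H \<Longrightarrow> x \<in> carrier M"
    using H.subset by auto
  show "\<zero>\<^bsub>M\<^esub> \<in> H" using H.one_closed by simp
  show "x \<in> H \<Longrightarrow> \<ominus>\<^bsub>M\<^esub> x \<in> H" using H.m_inv_closed by (simp add: a_inv_def)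
  show "x \<in> H \<Longrightarrow> y \<in> H \<Longrightarrow> x \<oplus>\<^bsub>M\<^esub> y \<in> H" using H.m_closed by simp
  show "a \<in> carrier R \<Longrightarrow> x \<in> H \<Longrightarrow> a \<odot>\<^bsub>M\<^esub> x \<in> H" by simp
qed

lemma left_module_submodule:
  assumes "submodule U R M"
  shows "left_module R (M\<lparr>carrier := U\<rparr>)"
proof -
  note D = submoduleD[OF assms]
  have "abelian_group (M\<lparr>carrier := U\<rparr>)"
  proof (rule abelian_groupI)
    show "\<exists>y\<in>carrier (M\<lparr>carrier := U\<rparr>). y \<oplus>\<^bsub>M\<lparr>carrier := U\<rparr>\<^esub> x = \<zero>\<^bsub>M\<lparr>carrier := U\<rparr>\<^esub>"
      if "x \<in> carrier (M\<lparr>carrier := U\<rparr>)" for x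
      using that D by (auto intro!: bexI[of _ "\<ominus>\<^bsub>M\<^esub> x"] simp: M.l_neg)
  qed (use D in \<open>auto simp: M.a_ac\<close>)
  then show ?thesis
    using R.ring_axioms D
    by (auto intro!: left_module.intro left_module_axioms.intro
        simp: smult_l_distr smult_r_distr smult_assoc1)
qed

lemma submodule_within:
  assumes "submodule U R M"
  shows "submodule A R (M\<lparr>carrier := U\<rparr>) \<longleftrightarrow> submodule A R M \<and> A \<subseteq> U"
proof
  interpret U: left_module R "M\<lparr>carrier := U\<rparr>" by (rule left_module_submodule[OF assms])
  have inv: "\<ominus>\<^bsub>M\<lparr>carrier := U\<rparr>\<^esub> x = \<ominus>\<^bsub>M\<^esub> x" if "x \<in> U" for x
    using that U.M.l_neg[of x] U.M.a_inv_closed[of x] submoduleD(2)[OF assms]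
    by (intro M.minus_equality[symmetric]) auto
  show "submodule A R M \<and> A \<subseteq> U" if *: "submodule A R (M\<lparr>carrier := U\<rparr>)"
  proof -
    note D = U.submoduleD[OF *, simplified]
    show ?thesis
      using D inv submoduleD(2)[OF assms] by (auto intro!: submoduleI)
  qed
  show "submodule A R (M\<lparr>carrier := U\<rparr>)" if *: "submodule A R M \<and> A \<subseteq> U"
    using * inv submoduleD[of A] by (intro U.submoduleI) (auto simp: subset_iff)
qed

lemma submodule_carrier: "submodule (carrier M) R M"
  by (rule submoduleI) auto

lemma submodule_zero: "submodule {\<zero>\<^bsub>M\<^esub>} R M"
  by (rule submoduleI) (auto simp: smult_r_null)

lemma submodule_Int:
  assumes "submodule A R M" "submodule B R M"
  shows "submodule (A \<inter> B) R M"
  using submoduleD[OF assms(1)] submoduleD[OF assms(2)] by (intro submoduleI) auto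

lemma mem_sum: "x \<in> A <+>\<^bsub>M\<^esub> B \<longleftrightarrow> (\<exists>a\<in>A. \<exists>b\<in>B. x = a \<oplus>\<^bsub>M\<^esub> b)"
  unfolding set_add_def' by auto

lemma submodule_sum:
  assumes "submodule A R M" "submodule B R M"
  shows "submodule (A <+>\<^bsub>M\<^esub> B) R M"
proof (rule submoduleI)
  note A = submoduleD[OF assms(1)] and B = submoduleD[OF assms(2)]
  show "A <+>\<^bsub>M\<^esub> B \<subseteq> carrier M"
    using A(2) B(2) by (auto simp: mem_sum)
  show "\<zero>\<^bsub>M\<^esub> \<in> A <+>\<^bsub>M\<^esub> B"
    using A(3) B(3) by (auto simp: mem_sum intro!: bexI[of _ "\<zero>\<^bsub>M\<^esub>"])
  fix x assume "x \<in> A <+>\<^bsub>M\<^esub> B"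
  then obtain a b where x: "a \<in> A" "b \<in> B" "x = a \<oplus>\<^bsub>M\<^esub> b" by (auto simp: mem_sum)
  have "\<ominus>\<^bsub>M\<^esub> x = \<ominus>\<^bsub>M\<^esub> a \<oplus>\<^bsub>M\<^esub> \<ominus>\<^bsub>M\<^esub> b"
    using x A(2) B(2) by (simp add: M.minus_add)
  then show "\<ominus>\<^bsub>M\<^esub> x \<in> A <+>\<^bsub>M\<^esub> B"
    using x A(4) B(4) by (auto simp: mem_sum)
  show "c \<odot>\<^bsub>M\<^esub> x \<in> A <+>\<^bsub>M\<^esub> B" if "c \<in> carrier R" for c
    using that x A(2,6) B(2,6) smult_r_distr[of c a b] unfolding mem_sum by blast
  fix y assume "y \<in> A <+>\<^bsub>M\<^esub> B"
  then obtain a' b' where y: "a' \<in> A" "b' \<in> B" "y = a' \<oplus>\<^bsub>M\<^esub> b'" by (auto simp: mem_sum)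
  have "x \<oplus>\<^bsub>M\<^esub> y = (a \<oplus>\<^bsub>M\<^esub> a') \<oplus>\<^bsub>M\<^esub> (b \<oplus>\<^bsub>M\<^esub> b')"
    using x y A(2) B(2) by (simp add: M.a_ac)
  then show "x \<oplus>\<^bsub>M\<^esub> y \<in> A <+>\<^bsub>M\<^esub> B"
    using x y A(5) B(5) unfolding mem_sum by blast
qed

lemma sum_commute:
  assumes "A \<subseteq> carrier M" "B \<subseteq> carrier M"
  shows "A <+>\<^bsub>M\<^esub> B = B <+>\<^bsub>M\<^esub> A"
proof -
  have "X <+>\<^bsub>M\<^esub> Y \<subseteq> Y <+>\<^bsub>M\<^esub> X" if "X \<subseteq> carrier M" "Y \<subseteq> carrier M" for X Y
  proof
    fix x assume "x \<in> X <+>\<^bsub>M\<^esub> Y"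
    then obtain a b where x: "a \<in> X" "b \<in> Y" "x = a \<oplus>\<^bsub>M\<^esub> b" by (auto simp: mem_sum)
    then have "x = b \<oplus>\<^bsub>M\<^esub> a" using that M.a_comm by blast
    then show "x \<in> Y <+>\<^bsub>M\<^esub> X" using x mem_sum by blast
  qed
  then show ?thesis using assms by blast
qed

lemma sum_assoc:
  assumes "A \<subseteq> carrier M" "B \<subseteq> carrier M" "C \<subseteq> carrier M"
  shows "(A <+>\<^bsub>M\<^esub> B) <+>\<^bsub>M\<^esub> C = A <+>\<^bsub>M\<^esub> (B <+>\<^bsub>M\<^esub> C)"
  unfolding set_add_def using M.add.set_mult_assoc[OF assms] by simp

lemma subset_sum:
  assumes "submodule A R M" "submodule B R M"
  shows "A \<subseteq> A <+>\<^bsub>M\<^esub> B" "B \<subseteq> A <+>\<^bsub>M\<^esub> B"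
proof -
  note A = submoduleD[OF assms(1)] and B = submoduleD[OF assms(2)]
  show "A \<subseteq> A <+>\<^bsub>M\<^esub> B"
    using A(2) B(3) by (force simp: mem_sum)
  show "B \<subseteq> A <+>\<^bsub>M\<^esub> B"
    using A(3) B(2) by (force simp: mem_sum)
qed

lemma sum_subset:
  assumes "submodule U R M" "A \<subseteq> U" "B \<subseteq> U"
  shows "A <+>\<^bsub>M\<^esub> B \<subseteq> U"
  using assms(2,3) by (auto simp: mem_sum intro!: submoduleD(5)[OF assms(1)])

text \<open>
  All summands of summands are kept as subsets of the one module \<open>M\<close>, so that nested decompositions
  can be regrouped without changing the ambient module; \<open>decomposes_iff\<close> is the link to
  \<^const>\<open>internal_direct_sum\<close>.
\<close>

definition decomposes :: "'c set \<Rightarrow> 'c set \<Rightarrow> 'c set \<Rightarrow> bool"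
  where "decomposes U A B \<longleftrightarrow>
    submodule A R M \<and> submodule B R M \<and> A <+>\<^bsub>M\<^esub> B = U \<and> A \<inter> B = {\<zero>\<^bsub>M\<^esub>}"

lemma decomposes_carrier_iff: "decomposes (carrier M) A B \<longleftrightarrow> internal_direct_sum R M A B"
  unfolding decomposes_def internal_direct_sum_def by simp

lemma decomposes_iff:
  assumes "submodule U R M"
  shows "internal_direct_sum R (M\<lparr>carrier := U\<rparr>) A B \<longleftrightarrow> decomposes U A B"
proof -
  have "A <+>\<^bsub>M\<lparr>carrier := U\<rparr>\<^esub> B = A <+>\<^bsub>M\<^esub> B"
    by (simp add: set_add_def set_mult_def)
  then show ?thesis
    using subset_sum[of A B]
    unfolding decomposes_def internal_direct_sum_def submodule_within[OF assms] by auto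
qed

lemma decomposesI:
  assumes "submodule A R M" "submodule B R M" "A <+>\<^bsub>M\<^esub> B = U"
    and "\<And>x. x \<in> A \<Longrightarrow> x \<in> B \<Longrightarrow> x = \<zero>\<^bsub>M\<^esub>"
  shows "decomposes U A B"
  using assms submoduleD(3) unfolding decomposes_def by blast

lemma decomposesD:
  assumes "decomposes U A B"
  shows "submodule A R M" "submodule B R M" "submodule U R M" "A <+>\<^bsub>M\<^esub> B = U"
    "A \<subseteq> U" "B \<subseteq> U" "x \<in> A \<Longrightarrow> x \<in> B \<Longrightarrow> x = \<zero>\<^bsub>M\<^esub>"
  using assms submodule_sum[of A B] subset_sum[of A B] unfolding decomposes_def by auto

lemma decomposes_commute: "decomposes U A B \<Longrightarrow> decomposes U B A"
  unfolding decomposes_def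
  using sum_commute[of A B] submoduleD(1)[of A] submoduleD(1)[of B] by (simp add: Int_commute)

lemma decomposes_zero:
  assumes "submodule U R M"
  shows "decomposes U {\<zero>\<^bsub>M\<^esub>} U"
proof (rule decomposesI[OF submodule_zero assms])
  show "{\<zero>\<^bsub>M\<^esub>} <+>\<^bsub>M\<^esub> U = U"
    using submoduleD(2)[OF assms] by (auto simp: mem_sum)
qed auto

lemma decomposes_unique:
  assumes "decomposes U A B" "a \<in> A" "b \<in> B" "a' \<in> A" "b' \<in> B"
    and "a \<oplus>\<^bsub>M\<^esub> b = a' \<oplus>\<^bsub>M\<^esub> b'"
  shows "a = a'" "b = b'"
proof -
  note D = decomposesD[OF assms(1)]
  note A = submoduleD[OF D(1)] and B = submoduleD[OF D(2)]
  have c: "a \<in> carrier M" "b \<in> carrier M" "a' \<in> carrier M" "b' \<in> carrier M"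
    using assms A B by auto
  have "\<ominus>\<^bsub>M\<^esub> a' \<oplus>\<^bsub>M\<^esub> a = \<ominus>\<^bsub>M\<^esub> a' \<oplus>\<^bsub>M\<^esub> (a \<oplus>\<^bsub>M\<^esub> b) \<oplus>\<^bsub>M\<^esub> \<ominus>\<^bsub>M\<^esub> b"
    using c by (simp add: M.a_assoc M.r_neg)
  also have "\<dots> = b' \<oplus>\<^bsub>M\<^esub> \<ominus>\<^bsub>M\<^esub> b"
    unfolding assms(6) using c by (simp add: M.r_neg1)
  finally have eq: "\<ominus>\<^bsub>M\<^esub> a' \<oplus>\<^bsub>M\<^esub> a = b' \<oplus>\<^bsub>M\<^esub> \<ominus>\<^bsub>M\<^esub> b" .
  have "\<ominus>\<^bsub>M\<^esub> a' \<oplus>\<^bsub>M\<^esub> a \<in> A" "\<ominus>\<^bsub>M\<^esub> a' \<oplus>\<^bsub>M\<^esub> a \<in> B"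
    using assms(2-5) A(4,5) B(4,5) by (blast, unfold eq, blast)
  then have "\<ominus>\<^bsub>M\<^esub> a' \<oplus>\<^bsub>M\<^esub> a = \<zero>\<^bsub>M\<^esub>" by (rule D(7))
  then show "a = a'"
    using c by (metis M.minus_equality M.minus_minus M.a_comm M.a_inv_closed)
  then show "b = b'"
    using assms(6) c by simp
qed

lemma decomposes_assoc:
  assumes U: "decomposes U A V" and V: "decomposes V B C"
  shows "decomposes U (A <+>\<^bsub>M\<^esub> B) C" "decomposes (A <+>\<^bsub>M\<^esub> B) A B"
proof -
  note DU = decomposesD[OF U] and DV = decomposesD[OF V]
  show "decomposes (A <+>\<^bsub>M\<^esub> B) A B"
    using DU(1,7) DV(1,5) by (intro decomposesI) auto
  show "decomposes U (A <+>\<^bsub>M\<^esub> B) C"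
  proof (rule decomposesI)
    show "submodule (A <+>\<^bsub>M\<^esub> B) R M" using DU(1) DV(1) by (rule submodule_sum)
    show "submodule C R M" by (rule DV)
    show "A <+>\<^bsub>M\<^esub> B <+>\<^bsub>M\<^esub> C = U"
      using sum_assoc[of A B C] DU(1,4) DV(1,2,4) submoduleD(1) by simp
    fix x assume x: "x \<in> A <+>\<^bsub>M\<^esub> B" "x \<in> C"
    then obtain a b where ab: "a \<in> A" "b \<in> B" "x = a \<oplus>\<^bsub>M\<^esub> b" by (auto simp: mem_sum)
    have "\<zero>\<^bsub>M\<^esub> \<oplus>\<^bsub>M\<^esub> x = a \<oplus>\<^bsub>M\<^esub> b"
      using ab x DV(2) submoduleD(2) by simp
    then have "x = b"
      using decomposes_unique(2)[OF U, of "\<zero>\<^bsub>M\<^esub>" x a b] ab x DV(5,6) DU(1) submoduleD(3)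
      by blast
    then show "x = \<zero>\<^bsub>M\<^esub>" using x ab DV(7) by blast
  qed
qed

lemma decomposes_assoc':
  assumes "decomposes U V C" "decomposes V A B"
  shows "decomposes U A (B <+>\<^bsub>M\<^esub> C)" "decomposes (B <+>\<^bsub>M\<^esub> C) B C"
proof -
  have "C <+>\<^bsub>M\<^esub> B = B <+>\<^bsub>M\<^esub> C"
    using decomposesD(2)[OF assms(1)] decomposesD(2)[OF assms(2)] submoduleD(1) sum_commute by blast
  then show "decomposes U A (B <+>\<^bsub>M\<^esub> C)" "decomposes (B <+>\<^bsub>M\<^esub> C) B C"
    using decomposes_assoc[OF decomposes_commute[OF assms(1)] decomposes_commute[OF assms(2)],
        THEN decomposes_commute]
    by simp_all
qed

text \<open>An instance of the modular law of the lattice of submodules.\<close>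

lemma decomposes_between:
  assumes "decomposes U A B" "submodule V R M" "A \<subseteq> V" "V \<subseteq> U"
  shows "decomposes V A (V \<inter> B)"
proof (rule decomposesI)
  note D = decomposesD[OF assms(1)] and V = submoduleD[OF assms(2)]
  show "submodule A R M" "submodule (V \<inter> B) R M"
    using D assms(2) by (auto intro: submodule_Int)
  show "A <+>\<^bsub>M\<^esub> (V \<inter> B) = V"
  proof
    show "A <+>\<^bsub>M\<^esub> (V \<inter> B) \<subseteq> V" using assms by (intro sum_subset) auto
    show "V \<subseteq> A <+>\<^bsub>M\<^esub> (V \<inter> B)"
    proof
      fix v assume v: "v \<in> V"
      then have "v \<in> A <+>\<^bsub>M\<^esub> B" using assms(4) D(4) by blast
      then obtain a b where ab: "a \<in> A" "b \<in> B" "v = a \<oplus>\<^bsub>M\<^esub> b"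
        by (auto simp: mem_sum)
      then have "b = \<ominus>\<^bsub>M\<^esub> a \<oplus>\<^bsub>M\<^esub> v"
        using D(1,2) submoduleD(2) by (simp add: M.r_neg1)
      then have "b \<in> V" using v ab assms(3) V(4,5) by blast
      then show "v \<in> A <+>\<^bsub>M\<^esub> (V \<inter> B)" using ab by (auto simp: mem_sum)
    qed
  qed
  show "x = \<zero>\<^bsub>M\<^esub>" if "x \<in> A" "x \<in> V \<inter> B" for x using that D(7) by blast
qed

text \<open>
  If \<open>A\<close> and \<open>B\<close> are the terms of a direct sum, this is the projection onto \<open>A\<close> along \<open>B\<close>.
\<close>

definition component :: "'c set \<Rightarrow> 'c set \<Rightarrow> 'c \<Rightarrow> 'c"
  where "component A B x = (THE a. a \<in> A \<and> (\<exists>b\<in>B. x = a \<oplus>\<^bsub>M\<^esub> b))"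

lemma component_add:
  assumes "decomposes U A B" "a \<in> A" "b \<in> B"
  shows "component A B (a \<oplus>\<^bsub>M\<^esub> b) = a"
  unfolding component_def
  using assms decomposes_unique(1)[OF assms(1)] by (intro the_equality) blast+

lemma component_left:
  assumes "decomposes U A B" "a \<in> A"
  shows "component A B a = a"
  using component_add[OF assms submoduleD(3)[OF decomposesD(2)[OF assms(1)]]]
    submoduleD(2)[OF decomposesD(1)[OF assms(1)] assms(2)]
  by simp

lemma component_right:
  assumes "decomposes U A B" "b \<in> B"
  shows "component A B b = \<zero>\<^bsub>M\<^esub>"
  using component_add[OF assms(1) submoduleD(3)[OF decomposesD(1)[OF assms(1)]] assms(2)]
    submoduleD(2)[OF decomposesD(2)[OF assms(1)] assms(2)]
  by simp

lemma component_in: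
  assumes "decomposes U A B" "x \<in> U"
  shows "component A B x \<in> A"
proof -
  obtain a b where "a \<in> A" "b \<in> B" "x = a \<oplus>\<^bsub>M\<^esub> b"
    using assms(2) decomposesD(4)[OF assms(1)] mem_sum[of x A B] by blast
  then show ?thesis using component_add[OF assms(1)] by simp
qed

lemma component_sum:
  assumes "decomposes U A B" "x \<in> U"
  shows "component A B x \<oplus>\<^bsub>M\<^esub> component B A x = x"
proof -
  obtain a b where ab: "a \<in> A" "b \<in> B" "x = a \<oplus>\<^bsub>M\<^esub> b"
    using assms(2) decomposesD(4)[OF assms(1)] mem_sum[of x A B] by blast
  then have "x = b \<oplus>\<^bsub>M\<^esub> a"
    using decomposesD(1,2)[OF assms(1)] submoduleD(2) M.a_comm by blast
  then have "component B A x = b"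
    using ab component_add[OF decomposes_commute[OF assms(1)]] by simp
  then show ?thesis
    using ab component_add[OF assms(1)] by simp
qed

lemma component_hom:
  assumes "decomposes U A B"
  shows "component A B \<in> lmod_hom R (M\<lparr>carrier := U\<rparr>) (M\<lparr>carrier := A\<rparr>)"
proof -
  note D = decomposesD[OF assms]
  note A = submoduleD[OF D(1)] and B = submoduleD[OF D(2)]
  have "component A B (x \<oplus>\<^bsub>M\<^esub> y) = component A B x \<oplus>\<^bsub>M\<^esub> component A B y"
    if xy: "x \<in> U" "y \<in> U" for x y
  proof -
    obtain a b where x: "a \<in> A" "b \<in> B" "x = a \<oplus>\<^bsub>M\<^esub> b" using xy(1) D(4) mem_sum[of x A B] by blast
    obtain a' b' where y: "a' \<in> A" "b' \<in> B" "y = a' \<oplus>\<^bsub>M\<^esub> b'" using xy(2) D(4) mem_sum[of y A B] by blast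
    have "x \<oplus>\<^bsub>M\<^esub> y = (a \<oplus>\<^bsub>M\<^esub> a') \<oplus>\<^bsub>M\<^esub> (b \<oplus>\<^bsub>M\<^esub> b')"
      using x y A(2) B(2) by (simp add: M.a_ac)
    then show ?thesis
      using x y A(5) B(5) component_add[OF assms] by simp
  qed
  moreover have "component A B (c \<odot>\<^bsub>M\<^esub> x) = c \<odot>\<^bsub>M\<^esub> component A B x"
    if cx: "c \<in> carrier R" "x \<in> U" for c x
  proof -
    obtain a b where x: "a \<in> A" "b \<in> B" "x = a \<oplus>\<^bsub>M\<^esub> b" using cx(2) D(4) mem_sum[of x A B] by blast
    have "a \<in> carrier M" "b \<in> carrier M" using x A(2) B(2) by blast+
    then have "c \<odot>\<^bsub>M\<^esub> x = c \<odot>\<^bsub>M\<^esub> a \<oplus>\<^bsub>M\<^esub> c \<odot>\<^bsub>M\<^esub> b"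
      unfolding x(3) by (rule smult_r_distr[OF cx(1)])
    moreover have "c \<odot>\<^bsub>M\<^esub> a \<in> A" "c \<odot>\<^bsub>M\<^esub> b \<in> B" using cx x A(6) B(6) by blast+
    ultimately show ?thesis
      using x component_add[OF assms] by simp
  qed
  ultimately show ?thesis
    using component_in[OF assms] unfolding lmod_hom_def by auto
qed

end

section \<open>Homomorphisms and complements\<close>

lemma lmod_homI:
  assumes "\<And>x. x \<in> carrier M \<Longrightarrow> f x \<in> carrier N"
    and "\<And>x y. x \<in> carrier M \<Longrightarrow> y \<in> carrier M \<Longrightarrow> f (x \<oplus>\<^bsub>M\<^esub> y) = f x \<oplus>\<^bsub>N\<^esub> f y"
    and "\<And>a x. a \<in> carrier R \<Longrightarrow> x \<in> carrier M \<Longrightarrow> f (a \<odot>\<^bsub>M\<^esub> x) = a \<odot>\<^bsub>N\<^esub> f x"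
  shows "f \<in> lmod_hom R M N"
  using assms unfolding lmod_hom_def by auto

lemma lmod_homD:
  assumes "f \<in> lmod_hom R M N"
  shows "x \<in> carrier M \<Longrightarrow> f x \<in> carrier N"
    and "x \<in> carrier M \<Longrightarrow> y \<in> carrier M \<Longrightarrow> f (x \<oplus>\<^bsub>M\<^esub> y) = f x \<oplus>\<^bsub>N\<^esub> f y"
    and "a \<in> carrier R \<Longrightarrow> x \<in> carrier M \<Longrightarrow> f (a \<odot>\<^bsub>M\<^esub> x) = a \<odot>\<^bsub>N\<^esub> f x"
  using assms unfolding lmod_hom_def by auto

lemma lmod_hom_comp:
  assumes "f \<in> lmod_hom R M N" "g \<in> lmod_hom R N P"
  shows "(\<lambda>x. g (f x)) \<in> lmod_hom R M P"
  using lmod_homD[OF assms(1)] lmod_homD[OF assms(2)] by (intro lmod_homI) simp_all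

lemma lmod_hom_restrict_domain:
  assumes "f \<in> lmod_hom R (M\<lparr>carrier := U\<rparr>) N" "V \<subseteq> U"
  shows "f \<in> lmod_hom R (M\<lparr>carrier := V\<rparr>) N"
  using lmod_homD[OF assms(1)] assms(2) by (intro lmod_homI) (auto simp: subset_iff)

lemma lmod_hom_extend_codomain:
  assumes "f \<in> lmod_hom R M (N\<lparr>carrier := U\<rparr>)" "U \<subseteq> V"
  shows "f \<in> lmod_hom R M (N\<lparr>carrier := V\<rparr>)"
  using lmod_homD[OF assms(1)] assms(2) by (intro lmod_homI) (auto simp: subset_iff)

lemma lmod_hom_zero:
  assumes "left_module R M" "left_module R N" "f \<in> lmod_hom R M N"
  shows "f \<zero>\<^bsub>M\<^esub> = \<zero>\<^bsub>N\<^esub>"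
proof -
  interpret M: left_module R M by fact
  interpret N: left_module R N by fact
  note f = lmod_homD[OF assms(3)]
  have "f \<zero>\<^bsub>M\<^esub> \<oplus>\<^bsub>N\<^esub> f \<zero>\<^bsub>M\<^esub> = f \<zero>\<^bsub>M\<^esub>"
    using f(2)[of "\<zero>\<^bsub>M\<^esub>" "\<zero>\<^bsub>M\<^esub>"] by simp
  then show ?thesis
    using f(1)[of "\<zero>\<^bsub>M\<^esub>"] N.M.add.r_cancel_one'[of "f \<zero>\<^bsub>M\<^esub>" "f \<zero>\<^bsub>M\<^esub>"] by simp
qed

lemma lmod_hom_minus:
  assumes "left_module R M" "left_module R N" "f \<in> lmod_hom R M N" "x \<in> carrier M"
  shows "f (\<ominus>\<^bsub>M\<^esub> x) = \<ominus>\<^bsub>N\<^esub> f x"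
proof -
  interpret M: left_module R M by fact
  interpret N: left_module R N by fact
  note f = lmod_homD[OF assms(3)]
  have "f (\<ominus>\<^bsub>M\<^esub> x) \<oplus>\<^bsub>N\<^esub> f x = \<zero>\<^bsub>N\<^esub>"
    using f(2)[of "\<ominus>\<^bsub>M\<^esub> x" x] assms(4) lmod_hom_zero[OF assms(1-3)] by (simp add: M.M.l_neg)
  then show ?thesis
    using f(1) assms(4) by (intro N.M.minus_equality[symmetric]) auto
qed

context left_module
begin

lemma submodule_image:
  assumes "submodule U R M" "submodule V R M" "h \<in> lmod_hom R (M\<lparr>carrier := U\<rparr>) (M\<lparr>carrier := V\<rparr>)"
  shows "submodule (h ` U) R M"
proof -
  note U = submoduleD[OF assms(1)] and V = submoduleD[OF assms(2)]
  note h = lmod_homD[OF assms(3), simplified]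
  note lU = left_module_submodule[OF assms(1)] and lV = left_module_submodule[OF assms(2)]
  interpret U: left_module R "M\<lparr>carrier := U\<rparr>" by fact
  interpret V: left_module R "M\<lparr>carrier := V\<rparr>" by fact
  have "submodule (h ` U) R (M\<lparr>carrier := V\<rparr>)"
  proof (rule V.submoduleI)
    show "h ` U \<subseteq> carrier (M\<lparr>carrier := V\<rparr>)" using h by auto
    have "h \<zero>\<^bsub>M\<^esub> = \<zero>\<^bsub>M\<^esub>" using lmod_hom_zero[OF lU lV assms(3)] by simp
    then show "\<zero>\<^bsub>M\<lparr>carrier := V\<rparr>\<^esub> \<in> h ` U" using U(3) by force
    fix x assume "x \<in> h ` U"
    then obtain u where u: "u \<in> U" "x = h u" by blast
    have "\<ominus>\<^bsub>M\<lparr>carrier := U\<rparr>\<^esub> u \<in> U" using U.M.a_inv_closed[of u] u by simp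
    then show "\<ominus>\<^bsub>M\<lparr>carrier := V\<rparr>\<^esub> x \<in> h ` U"
      using lmod_hom_minus[OF lU lV assms(3), of u] u by force
    show "a \<odot>\<^bsub>M\<lparr>carrier := V\<rparr>\<^esub> x \<in> h ` U" if "a \<in> carrier R" for a
      using h(3)[OF that u(1)] u U(6)[OF that u(1)] by force
    fix y assume "y \<in> h ` U"
    then obtain w where w: "w \<in> U" "y = h w" by blast
    show "x \<oplus>\<^bsub>M\<lparr>carrier := V\<rparr>\<^esub> y \<in> h ` U"
      using h(2)[OF u(1) w(1)] u w U(5)[OF u(1) w(1)] by force
  qed
  then show ?thesis using submodule_within[OF assms(2)] by blast
qed

lemma submodule_preimage:
  assumes "submodule U R M" "submodule V R M" "h \<in> lmod_hom R (M\<lparr>carrier := U\<rparr>) (M\<lparr>carrier := V\<rparr>)"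
    and "submodule K R M"
  shows "submodule {x \<in> U. h x \<in> K} R M"
proof -
  note U = submoduleD[OF assms(1)] and K = submoduleD[OF assms(4)]
  note h = lmod_homD[OF assms(3), simplified]
  note lU = left_module_submodule[OF assms(1)] and lV = left_module_submodule[OF assms(2)]
  have zero: "h \<zero>\<^bsub>M\<^esub> = \<zero>\<^bsub>M\<^esub>" using lmod_hom_zero[OF lU lV assms(3)] by simp
  have minus: "h (\<ominus>\<^bsub>M\<^esub> x) = \<ominus>\<^bsub>M\<^esub> h x" if x: "x \<in> U" for x
  proof -
    have "h (\<ominus>\<^bsub>M\<^esub> x) \<oplus>\<^bsub>M\<^esub> h x = \<zero>\<^bsub>M\<^esub>"
      using h(2)[OF U(4)[OF x] x] zero U(2)[OF x] by (simp add: M.l_neg)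
    then show ?thesis
      using h(1) U(4) x submoduleD(2)[OF assms(2)] by (intro M.minus_equality[symmetric]) auto
  qed
  show ?thesis
  proof (rule submoduleI)
    show "{x \<in> U. h x \<in> K} \<subseteq> carrier M" using U(1) by blast
    show "\<zero>\<^bsub>M\<^esub> \<in> {x \<in> U. h x \<in> K}" using zero U(3) K(3) by simp
    fix x assume x: "x \<in> {x \<in> U. h x \<in> K}"
    then show "\<ominus>\<^bsub>M\<^esub> x \<in> {x \<in> U. h x \<in> K}" using minus U(4) K(4) by simp
    show "a \<odot>\<^bsub>M\<^esub> x \<in> {x \<in> U. h x \<in> K}" if "a \<in> carrier R" for a
      using that x h(3) U(6) K(6) by simp
    fix y assume "y \<in> {x \<in> U. h x \<in> K}"
    then show "x \<oplus>\<^bsub>M\<^esub> y \<in> {x \<in> U. h x \<in> K}" using x h(2) U(5) K(5) by simp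
  qed
qed

text \<open>
  A homomorphism that is bijective on a submodule \<open>F\<close> splits off \<open>F\<close>: for \<open>x \<in> U\<close> there is \<open>f \<in> F\<close> with
  the same image, and \<open>x\<close> is the sum of \<open>f\<close> and an element of the kernel. All new decompositions in the
  exchange argument arise in this way.
\<close>

lemma decomposes_kernel:
  assumes "submodule U R M" "submodule V R M" "h \<in> lmod_hom R (M\<lparr>carrier := U\<rparr>) (M\<lparr>carrier := V\<rparr>)"
    and "submodule F R M" "F \<subseteq> U" "bij_betw h F V"
  shows "decomposes U F {x \<in> U. h x = \<zero>\<^bsub>M\<^esub>}"
proof (rule decomposesI)
  note U = submoduleD[OF assms(1)] and V = submoduleD[OF assms(2)] and F = submoduleD[OF assms(4)]
  note h = lmod_homD[OF assms(3), simplified]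
  show "submodule F R M" by fact
  show K: "submodule {x \<in> U. h x = \<zero>\<^bsub>M\<^esub>} R M"
    using submodule_preimage[OF assms(1-3) submodule_zero] by simp
  have zero: "h \<zero>\<^bsub>M\<^esub> = \<zero>\<^bsub>M\<^esub>"
    using lmod_hom_zero[OF left_module_submodule[OF assms(1)] left_module_submodule[OF assms(2)]
        assms(3)] by simp
  show "x = \<zero>\<^bsub>M\<^esub>" if "x \<in> F" "x \<in> {x \<in> U. h x = \<zero>\<^bsub>M\<^esub>}" for x
    using that zero F(3) assms(6) unfolding bij_betw_def inj_on_def by auto
  show "F <+>\<^bsub>M\<^esub> {x \<in> U. h x = \<zero>\<^bsub>M\<^esub>} = U"
  proof
    show "F <+>\<^bsub>M\<^esub> {x \<in> U. h x = \<zero>\<^bsub>M\<^esub>} \<subseteq> U" using assms by (intro sum_subset) auto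
    show "U \<subseteq> F <+>\<^bsub>M\<^esub> {x \<in> U. h x = \<zero>\<^bsub>M\<^esub>}"
    proof
      fix x assume x: "x \<in> U"
      have "h x \<in> h ` F" using h(1)[OF x] assms(6) unfolding bij_betw_def by simp
      then obtain f where f: "f \<in> F" "h f = h x" by force
      define k where "k = \<ominus>\<^bsub>M\<^esub> f \<oplus>\<^bsub>M\<^esub> x"
      have fU: "f \<in> U" using f assms(5) by blast
      have kU: "k \<in> U" unfolding k_def using x U(4,5) fU by simp
      have c: "x \<in> carrier M" "f \<in> carrier M" "k \<in> carrier M" "h k \<in> carrier M" "h f \<in> carrier M"
        using x fU kU U(2) h(1) V(2) by auto
      have xk: "x = f \<oplus>\<^bsub>M\<^esub> k"
        unfolding k_def using c by (simp add: M.r_neg2)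
      have "h f \<oplus>\<^bsub>M\<^esub> h k = h f" using h(2)[OF fU kU] xk f(2) by simp
      then have "h k = \<zero>\<^bsub>M\<^esub>" using c M.add.l_cancel_one'[of "h f" "h k"] by auto
      then show "x \<in> F <+>\<^bsub>M\<^esub> {x \<in> U. h x = \<zero>\<^bsub>M\<^esub>}"
        using xk f(1) kU unfolding mem_sum by blast
    qed
  qed
qed

text \<open>
  Two complements of \<open>A\<close> are both isomorphic to the quotient by \<open>A\<close>. The isomorphism can be written
  down without forming the quotient: project each complement along \<open>A\<close> onto the other one.
\<close>

lemma complement_isomorphic:
  assumes B: "decomposes U B A" and B': "decomposes U B' A"
  shows "lmod_isomorphic R (M\<lparr>carrier := B\<rparr>) (M\<lparr>carrier := B'\<rparr>)"
proof -
  note D = decomposesD[OF B] and D' = decomposesD[OF B']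
  let ?h = "component B' A"
  have hom: "?h \<in> lmod_hom R (M\<lparr>carrier := B\<rparr>) (M\<lparr>carrier := B'\<rparr>)"
    using lmod_hom_restrict_domain[OF component_hom[OF B'] D(5)] .
  have "bij_betw ?h B B'"
  proof (rule bij_betwI)
    show "?h \<in> B \<rightarrow> B'" "component B A \<in> B' \<rightarrow> B"
      using component_in[OF B'] component_in[OF B] D(5) D'(5) by auto
    have inv: "component X A (component Y A x) = x"
      if X: "decomposes U X A" and Y: "decomposes U Y A" and x: "x \<in> X" for X Y x
    proof -
      note DX = decomposesD[OF X] and DY = decomposesD[OF Y]
      have xU: "x \<in> U" using x DX(5) by blast
      define y z where "y = component Y A x" and "z = component A Y x"
      have y: "y \<in> Y" and z: "z \<in> A" and yz: "y \<oplus>\<^bsub>M\<^esub> z = x"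
        unfolding y_def z_def using component_in[OF Y xU] component_sum[OF Y xU]
          component_in[OF decomposes_commute[OF Y] xU] by auto
      have c: "y \<in> carrier M" "z \<in> carrier M" using y z DY(1,2) submoduleD(2) by blast+
      then have "y = x \<oplus>\<^bsub>M\<^esub> \<ominus>\<^bsub>M\<^esub> z" unfolding yz[symmetric] by (simp add: M.a_assoc M.r_neg)
      then show ?thesis
        using component_add[OF X x submoduleD(4)[OF DX(2) z]] unfolding y_def by simp
    qed
    show "component B A (?h x) = x" if "x \<in> B" for x using inv[OF B B' that] .
    show "?h (component B A y) = y" if "y \<in> B'" for y using inv[OF B' B that] .
  qed
  then show ?thesis using hom unfolding lmod_isomorphic_def by auto
qed

end

section \<open>Local endomorphism rings\<close>

lemma left_ideal_eq_carrier:
  assumes "ring S" "left_ideal I S" "\<one>\<^bsub>S\<^esub> \<in> I"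
  shows "I = carrier S"
proof -
  interpret S: ring S by fact
  interpret I: additive_subgroup I S using assms(2) by (simp add: left_ideal_def)
  have "x \<in> I" if "x \<in> carrier S" for x
  proof -
    have "x \<otimes>\<^bsub>S\<^esub> \<one>\<^bsub>S\<^esub> \<in> I" using assms(2,3) that unfolding left_ideal_def by blast
    then show ?thesis using that by simp
  qed
  then show ?thesis using I.a_subset by blast
qed

lemma left_ideal_principal:
  assumes "ring S" "a \<in> carrier S"
  shows "left_ideal ((\<lambda>x. x \<otimes>\<^bsub>S\<^esub> a) ` carrier S) S"
proof -
  interpret S: ring S by fact
  have "subgroup ((\<lambda>x. x \<otimes>\<^bsub>S\<^esub> a) ` carrier S) (add_monoid S)"
  proof (rule S.add.subgroupI)
    show "(\<lambda>x. x \<otimes>\<^bsub>S\<^esub> a) ` carrier S \<subseteq> carrier S" using assms(2) by auto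
    show "(\<lambda>x. x \<otimes>\<^bsub>S\<^esub> a) ` carrier S \<noteq> {}" by auto
    fix x assume "x \<in> (\<lambda>x. x \<otimes>\<^bsub>S\<^esub> a) ` carrier S"
    then obtain u where u: "u \<in> carrier S" "x = u \<otimes>\<^bsub>S\<^esub> a" by blast
    then have "\<ominus>\<^bsub>S\<^esub> x = \<ominus>\<^bsub>S\<^esub> u \<otimes>\<^bsub>S\<^esub> a" using assms(2) by (simp add: S.l_minus)
    then show "\<ominus>\<^bsub>S\<^esub> x \<in> (\<lambda>x. x \<otimes>\<^bsub>S\<^esub> a) ` carrier S" using u by blast
    fix y assume "y \<in> (\<lambda>x. x \<otimes>\<^bsub>S\<^esub> a) ` carrier S"
    then obtain w where w: "w \<in> carrier S" "y = w \<otimes>\<^bsub>S\<^esub> a" by blast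
    then have "x \<oplus>\<^bsub>S\<^esub> y = (u \<oplus>\<^bsub>S\<^esub> w) \<otimes>\<^bsub>S\<^esub> a" using assms(2) u by (simp add: S.l_distr)
    then show "x \<oplus>\<^bsub>S\<^esub> y \<in> (\<lambda>x. x \<otimes>\<^bsub>S\<^esub> a) ` carrier S" using u w by blast
  qed
  moreover have "b \<otimes>\<^bsub>S\<^esub> (x \<otimes>\<^bsub>S\<^esub> a) \<in> (\<lambda>x. x \<otimes>\<^bsub>S\<^esub> a) ` carrier S"
    if "b \<in> carrier S" "x \<in> carrier S" for b x
    using that assms(2) S.m_assoc[of b x a] by (metis S.m_closed imageI)
  ultimately show ?thesis
    unfolding left_ideal_def by (auto intro: additive_subgroup.intro)
qed

text \<open>Krull's theorem, by Zorn's lemma applied to the left ideals above \<open>I\<close> that do not contain \<open>1\<close>.\<close>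

lemma exists_maximal_left_ideal:
  assumes "ring S" "left_ideal I S" "\<one>\<^bsub>S\<^esub> \<notin> I"
  shows "\<exists>J. maximal_left_ideal J S \<and> I \<subseteq> J"
proof -
  interpret S: ring S by fact
  let ?P = "{L. left_ideal L S \<and> I \<subseteq> L \<and> \<one>\<^bsub>S\<^esub> \<notin> L}"
  have "\<exists>J\<in>?P. \<forall>L\<in>?P. J \<subseteq> L \<longrightarrow> L = J"
  proof (rule subset_Zorn_nonempty)
    show "?P \<noteq> {}" using assms(2,3) by blast
    fix \<C> assume ne: "\<C> \<noteq> {}" and ch: "subset.chain ?P \<C>"
    have mem: "left_ideal L S" "I \<subseteq> L" "\<one>\<^bsub>S\<^esub> \<notin> L" if "L \<in> \<C>" for L
      using ch that unfolding subset.chain_def by auto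
    have sub: "subgroup L (add_monoid S)" if "L \<in> \<C>" for L
      using mem(1)[OF that] unfolding left_ideal_def by (auto dest: additive_subgroup.a_subgroup)
    have "subgroup (\<Union>\<C>) (add_monoid S)"
    proof (rule S.add.subgroupI)
      show "\<Union>\<C> \<subseteq> carrier S" using sub subgroup.subset by fastforce
      show "\<Union>\<C> \<noteq> {}" using ne sub subgroup.one_closed by fastforce
      fix x assume "x \<in> \<Union>\<C>"
      then obtain L where L: "L \<in> \<C>" "x \<in> L" by blast
      then show "\<ominus>\<^bsub>S\<^esub> x \<in> \<Union>\<C>"
        using subgroup.m_inv_closed[OF sub[OF L(1)] L(2)] by (auto simp: a_inv_def)
      fix y assume "y \<in> \<Union>\<C>"
      then obtain K where K: "K \<in> \<C>" "y \<in> K" by blast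
      have "L \<subseteq> K \<or> K \<subseteq> L"
        using ch L(1) K(1) unfolding subset.chain_def by auto
      then obtain N where "N \<in> \<C>" "x \<in> N" "y \<in> N" using L K by blast
      then show "x \<oplus>\<^bsub>S\<^esub> y \<in> \<Union>\<C>"
        using subgroup.m_closed[OF sub, of N x y] by auto
    qed
    then have "left_ideal (\<Union>\<C>) S"
      using mem(1) unfolding left_ideal_def by (auto intro: additive_subgroup.intro)
    then show "\<Union>\<C> \<in> ?P" using mem(2,3) ne by blast
  qed
  then obtain J where JP: "J \<in> ?P" and max: "\<And>L. L \<in> ?P \<Longrightarrow> J \<subseteq> L \<Longrightarrow> L = J" by meson
  then have J: "left_ideal J S" "I \<subseteq> J" "\<one>\<^bsub>S\<^esub> \<notin> J" by auto
  have "L = J \<or> L = carrier S" if "left_ideal L S" "J \<subseteq> L" for L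
  proof (cases "\<one>\<^bsub>S\<^esub> \<in> L")
    case True
    then show ?thesis using left_ideal_eq_carrier[OF assms(1) that(1)] by simp
  next
    case False
    then show ?thesis using max[of L] that J(2) by simp
  qed
  then have "maximal_left_ideal J S"
    unfolding maximal_left_ideal_def using J(1,3) S.one_closed by blast
  then show ?thesis using J(2) by blast
qed

text \<open>
  If neither \<open>a\<close> nor \<open>b\<close> had a left inverse, both principal left ideals would be proper and thus lie in
  the only maximal left ideal, which would then contain \<open>a + b = 1\<close>. One-sided inverses are all that the
  exchange argument needs.
\<close>

lemma local_ring_left_inverse:
  assumes "local_ring S" "a \<in> carrier S" "b \<in> carrier S" "a \<oplus>\<^bsub>S\<^esub> b = \<one>\<^bsub>S\<^esub>"
  shows "\<exists>c\<in>carrier S. c \<otimes>\<^bsub>S\<^esub> a = \<one>\<^bsub>S\<^esub> \<or> c \<otimes>\<^bsub>S\<^esub> b = \<one>\<^bsub>S\<^esub>"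
proof (rule ccontr)
  assume no: "\<not> ?thesis"
  have S: "ring S" using assms(1) by (simp add: local_ring_def)
  interpret S: ring S by fact
  obtain J where J: "maximal_left_ideal J S" and uniq: "\<And>L. maximal_left_ideal L S \<Longrightarrow> L = J"
    using assms(1) unfolding local_ring_def by blast
  have inJ: "x \<in> J" if x: "x \<in> carrier S" and ni: "\<forall>c\<in>carrier S. c \<otimes>\<^bsub>S\<^esub> x \<noteq> \<one>\<^bsub>S\<^esub>" for x
  proof -
    have "\<one>\<^bsub>S\<^esub> \<notin> (\<lambda>c. c \<otimes>\<^bsub>S\<^esub> x) ` carrier S" using ni by force
    then have "(\<lambda>c. c \<otimes>\<^bsub>S\<^esub> x) ` carrier S \<subseteq> J"
      using exists_maximal_left_ideal[OF S left_ideal_principal[OF S x]] uniq by blast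
    moreover have "\<one>\<^bsub>S\<^esub> \<otimes>\<^bsub>S\<^esub> x \<in> (\<lambda>c. c \<otimes>\<^bsub>S\<^esub> x) ` carrier S" by blast
    ultimately show ?thesis using x by auto
  qed
  have L: "left_ideal J S" and ne: "J \<noteq> carrier S"
    using J by (auto simp: maximal_left_ideal_def)
  interpret J: additive_subgroup J S using L by (simp add: left_ideal_def)
  have "a \<in> J" "b \<in> J" using inJ assms(2,3) no by blast+
  then have "\<one>\<^bsub>S\<^esub> \<in> J" using J.a_closed[of a b] assms(4) by simp
  then show False using left_ideal_eq_carrier[OF S L] ne by blast
qed

text \<open>
  The same fact for maps that are not cut off outside the carrier, so that compositions of
  projections can be used for \<open>u\<close> and \<open>v\<close>.
\<close>

lemma (in left_module) strongly_indecomposable_left_inverse: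
  assumes "strongly_indecomposable R M" "u \<in> lmod_hom R M M" "v \<in> lmod_hom R M M"
    and sum: "\<And>x. x \<in> carrier M \<Longrightarrow> u x \<oplus>\<^bsub>M\<^esub> v x = x"
  shows "\<exists>c \<in> lmod_hom R M M.
    (\<forall>x\<in>carrier M. c (u x) = x) \<or> (\<forall>x\<in>carrier M. c (v x) = x)"
proof -
  let ?S = "endomorphism_ring R M"
  have mem: "restrict w (carrier M) \<in> carrier ?S" if "w \<in> lmod_hom R M M" for w
    using that lmod_homD[OF that] unfolding endomorphism_ring_def
    by (auto intro!: lmod_homI)
  have "\<exists>c\<in>carrier ?S. c \<otimes>\<^bsub>?S\<^esub> restrict u (carrier M) = \<one>\<^bsub>?S\<^esub>
      \<or> c \<otimes>\<^bsub>?S\<^esub> restrict v (carrier M) = \<one>\<^bsub>?S\<^esub>"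
  proof (rule local_ring_left_inverse)
    show "local_ring ?S" using assms(1) by (simp add: strongly_indecomposable_def)
    show "restrict u (carrier M) \<oplus>\<^bsub>?S\<^esub> restrict v (carrier M) = \<one>\<^bsub>?S\<^esub>"
      using sum by (auto simp: endomorphism_ring_def fun_eq_iff)
  qed (use mem assms in auto)
  then obtain c where c: "c \<in> lmod_hom R M M"
    and eq: "compose (carrier M) c (restrict u (carrier M)) = (\<lambda>x\<in>carrier M. x)
      \<or> compose (carrier M) c (restrict v (carrier M)) = (\<lambda>x\<in>carrier M. x)"
    by (auto simp: endomorphism_ring_def)
  have "c (w x) = x"
    if "compose (carrier M) c (restrict w (carrier M)) = (\<lambda>x\<in>carrier M. x)" "x \<in> carrier M" for w x
    using fun_cong[OF that(1), of x] that(2) by (simp add: compose_def)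
  then show ?thesis using c eq by blast
qed

section \<open>The exchange argument\<close>

text \<open>The chain condition in the form of a minimal condition, by dependent choice.\<close>

lemma krull_schmidt_artinian_minimal:
  assumes "krull_schmidt_artinian R M" "\<S> \<subseteq> direct_summands R M" "\<S> \<noteq> {}"
  obtains W where "W \<in> \<S>" "\<And>V. V \<in> \<S> \<Longrightarrow> V \<subseteq> W \<Longrightarrow> V = W"
proof (rule ccontr)
  assume no: "\<not> thesis"
  have step: "\<exists>V. V \<in> \<S> \<and> V \<subset> W" if "W \<in> \<S>" for W
    using that no \<open>\<And>W. \<lbrakk>W \<in> \<S>; \<And>V. \<lbrakk>V \<in> \<S>; V \<subseteq> W\<rbrakk> \<Longrightarrow> V = W\<rbrakk> \<Longrightarrow> thesis\<close> by blast
  have "\<exists>X. \<forall>n. X n \<in> \<S> \<and> X (Suc n) \<subset> X n"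
    by (rule dependent_nat_choice) (use assms(3) step in auto)
  then obtain X where X: "\<And>n. X n \<in> \<S>" "\<And>n. X (Suc n) \<subset> X n" by meson
  have "\<forall>n. X n \<in> direct_summands R M" "\<forall>n. X (Suc n) \<subseteq> X n"
    using X assms(2) by (blast, simp add: psubset_imp_subset)
  then obtain n where n: "\<forall>m\<ge>n. X m = X n"
    using assms(1) unfolding krull_schmidt_artinian_def by meson
  have "X (Suc n) = X n" by (rule n[rule_format]) simp
  then show False using X(2)[of n] by simp
qed

context left_module
begin

lemma mem_direct_summands: "A \<in> direct_summands R M \<longleftrightarrow> (\<exists>B. decomposes (carrier M) A B)"
  unfolding direct_summands_def decomposes_carrier_iff by simp

text \<open>
  Let \<open>q\<close> be the projection of \<open>M = X \<oplus> C \<oplus> D\<close> onto \<open>C\<close>; the assumption says that \<open>g \<circ> q\<close> is the identity on \<open>E\<close>.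
  So \<open>g\<close> maps \<open>q(E)\<close> bijectively to \<open>E\<close>, which splits \<open>C\<close> into \<open>C\<^sub>1 = q(E)\<close> and \<open>C\<^sub>2 = C \<inter> ker g\<close>. Likewise
  \<open>g \<circ> q\<close> splits \<open>M\<close> into \<open>E\<close> and its kernel, and this kernel is \<open>X \<oplus> C\<^sub>2 \<oplus> D\<close>. Thus \<open>E\<close> has taken the
  place of \<open>C\<^sub>1\<close>, and \<open>V = C\<^sub>2 \<oplus> D\<close> is strictly smaller than \<open>W = C \<oplus> D\<close> because \<open>E\<close> is nonzero.
\<close>

lemma exchange_step:
  assumes XW: "decomposes (carrier M) X W" and CD: "decomposes W C D"
    and E: "submodule E R M" "E \<noteq> {\<zero>\<^bsub>M\<^esub>}"
    and g: "g \<in> lmod_hom R M (M\<lparr>carrier := E\<rparr>)"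
    and ge: "\<forall>e\<in>E. g (component C D (component W X e)) = e"
  obtains C\<^sub>1 C\<^sub>2 V where "decomposes C C\<^sub>1 C\<^sub>2" "decomposes V C\<^sub>2 D" "V \<subset> W"
    "decomposes (carrier M) (X <+>\<^bsub>M\<^esub> E) V"
proof -
  note XW' = decomposes_commute[OF XW]
  note X = decomposesD[OF XW] and C = decomposesD[OF CD]
  note Esub = submoduleD[OF E(1)]
  define q where "q x = component C D (component W X x)" for x
  define C\<^sub>1 where "C\<^sub>1 = q ` E"
  define C\<^sub>2 where "C\<^sub>2 = {c \<in> C. g c = \<zero>\<^bsub>M\<^esub>}"
  define V where "V = C\<^sub>2 <+>\<^bsub>M\<^esub> D"
  have q: "q \<in> lmod_hom R M (M\<lparr>carrier := C\<rparr>)"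
    unfolding q_def using lmod_hom_comp[OF component_hom[OF XW'] component_hom[OF CD]] by simp
  have qin: "q x \<in> C" if "x \<in> carrier M" for x
    unfolding q_def using that component_in[OF XW'] component_in[OF CD] by blast
  have ge': "g (q e) = e" if "e \<in> E" for e unfolding q_def using ge that by blast
  have gC: "g \<in> lmod_hom R (M\<lparr>carrier := C\<rparr>) (M\<lparr>carrier := E\<rparr>)"
    using lmod_hom_restrict_domain[where U = "carrier M" and M = M] g submoduleD(1)[OF C(1)] by simp
  have C1: "submodule C\<^sub>1 R M" "C\<^sub>1 \<subseteq> C"
  proof -
    have "q \<in> lmod_hom R (M\<lparr>carrier := E\<rparr>) (M\<lparr>carrier := C\<rparr>)"
      using lmod_hom_restrict_domain[where U = "carrier M" and M = M] q Esub(1) by simp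
    then show "submodule C\<^sub>1 R M" unfolding C\<^sub>1_def by (rule submodule_image[OF E(1) C(1)])
    show "C\<^sub>1 \<subseteq> C" using qin Esub(1) unfolding C\<^sub>1_def by blast
  qed
  have "bij_betw g C\<^sub>1 E"
    unfolding C\<^sub>1_def using ge' by (intro bij_betw_byWitness[where f' = q]) auto
  then have C12: "decomposes C C\<^sub>1 C\<^sub>2"
    unfolding C\<^sub>2_def using decomposes_kernel[OF C(1) E(1) gC C1] by blast
  note C2 = decomposesD[OF C12]
  have VCD: "decomposes V C\<^sub>2 D"
    unfolding V_def using C2(2,6) C(2,7) by (intro decomposesI) auto
  note V = decomposesD[OF VCD]
  have VW: "V \<subseteq> W"
    unfolding V_def using C2(6) C(3,5,6) by (intro sum_subset) auto
  have "V \<noteq> W"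
  proof
    assume "V = W"
    obtain e where e: "e \<in> E" "e \<noteq> \<zero>\<^bsub>M\<^esub>" using E(2) Esub(3) by blast
    have c: "q e \<in> C" using e qin Esub(2) by blast
    then have "q e \<in> V" using \<open>V = W\<close> C(5) by blast
    then obtain c d where cd: "c \<in> C\<^sub>2" "d \<in> D" "q e = c \<oplus>\<^bsub>M\<^esub> d" using V(4) mem_sum by blast
    then have "component C D (q e) = c"
      using component_add[OF CD, of c d] C2(6) by auto
    then have "q e = c" using component_left[OF CD c] by simp
    then have "g (q e) = \<zero>\<^bsub>M\<^esub>" using cd(1) unfolding C\<^sub>2_def by simp
    then show False using ge' e by simp
  qed
  let ?h = "\<lambda>x. g (q x)"
  have h: "?h \<in> lmod_hom R (M\<lparr>carrier := carrier M\<rparr>) (M\<lparr>carrier := E\<rparr>)"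
    using lmod_hom_comp[OF q gC] by simp
  have "bij_betw ?h E E"
    using ge' by (intro bij_betw_byWitness[where f' = ?h]) auto
  then have EK: "decomposes (carrier M) E {x \<in> carrier M. ?h x = \<zero>\<^bsub>M\<^esub>}"
    using decomposes_kernel[OF submodule_carrier E(1) h E(1) Esub(1)] by blast
  have "{x \<in> carrier M. ?h x = \<zero>\<^bsub>M\<^esub>} = X <+>\<^bsub>M\<^esub> V"
  proof
    show "{x \<in> carrier M. ?h x = \<zero>\<^bsub>M\<^esub>} \<subseteq> X <+>\<^bsub>M\<^esub> V"
    proof
      fix x assume "x \<in> {x \<in> carrier M. ?h x = \<zero>\<^bsub>M\<^esub>}"
      then have x: "x \<in> carrier M" "g (q x) = \<zero>\<^bsub>M\<^esub>" by auto
      let ?w = "component W X x"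
      have w: "?w \<in> W" using component_in[OF XW' x(1)] .
      have "q x \<in> C\<^sub>2" using x qin unfolding C\<^sub>2_def by simp
      moreover have "component D C ?w \<in> D" using component_in[OF decomposes_commute[OF CD] w] .
      moreover have "?w = q x \<oplus>\<^bsub>M\<^esub> component D C ?w"
        unfolding q_def using component_sum[OF CD w] by simp
      ultimately have "?w \<in> V" unfolding V_def mem_sum by blast
      moreover have "component X W x \<in> X" using component_in[OF XW x(1)] .
      moreover have "x = component X W x \<oplus>\<^bsub>M\<^esub> ?w" using component_sum[OF XW x(1)] by simp
      ultimately show "x \<in> X <+>\<^bsub>M\<^esub> V" unfolding mem_sum by blast
    qed
    show "X <+>\<^bsub>M\<^esub> V \<subseteq> {x \<in> carrier M. ?h x = \<zero>\<^bsub>M\<^esub>}"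
    proof
      fix x assume "x \<in> X <+>\<^bsub>M\<^esub> V"
      then obtain y v where y: "y \<in> X" "v \<in> V" "x = y \<oplus>\<^bsub>M\<^esub> v" using mem_sum by blast
      then obtain c d where c: "c \<in> C\<^sub>2" "d \<in> D" "v = c \<oplus>\<^bsub>M\<^esub> d" unfolding V_def using mem_sum by blast
      have carr: "y \<in> carrier M" "v \<in> carrier M"
        using y X(1) V(3) submoduleD(2) by blast+
      have vW: "v \<in> W" using y(2) VW by blast
      have "x = v \<oplus>\<^bsub>M\<^esub> y" using y(3) carr M.a_comm by simp
      then have "component W X x = v" using component_add[OF XW' vW y(1)] by simp
      moreover have "component C D v = c"
        unfolding c(3) using component_add[OF CD _ c(2)] c(1) C2(6) by blast
      ultimately have "q x = c" unfolding q_def by simp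
      then have "g (q x) = \<zero>\<^bsub>M\<^esub>" using c(1) unfolding C\<^sub>2_def by simp
      then show "x \<in> {x \<in> carrier M. ?h x = \<zero>\<^bsub>M\<^esub>}" using y carr by simp
    qed
  qed
  then have EXV: "decomposes (carrier M) E (X <+>\<^bsub>M\<^esub> V)" using EK by simp
  have XV: "decomposes (X <+>\<^bsub>M\<^esub> V) X V"
    using X(1,7) V(3) VW by (intro decomposesI) auto
  have "E <+>\<^bsub>M\<^esub> X = X <+>\<^bsub>M\<^esub> E"
    using Esub(1) submoduleD(1)[OF X(1)] by (rule sum_commute)
  then have "decomposes (carrier M) (X <+>\<^bsub>M\<^esub> E) V"
    using decomposes_assoc(1)[OF EXV XV] by simp
  then show thesis using that C12 VCD VW \<open>V \<noteq> W\<close> by blast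
qed

lemma indecomposable_minimal_summand:
  assumes E: "decomposes (carrier M) E F" "E \<noteq> {\<zero>\<^bsub>M\<^esub>}"
    and min: "\<And>V. V \<in> direct_summands R M \<Longrightarrow> V \<subseteq> E \<Longrightarrow> V \<noteq> {\<zero>\<^bsub>M\<^esub>} \<Longrightarrow> V = E"
  shows "indecomposable R (M\<lparr>carrier := E\<rparr>)"
proof -
  have "G = {\<zero>\<^bsub>M\<^esub>} \<or> H = {\<zero>\<^bsub>M\<^esub>}" if GH: "decomposes E G H" for G H
  proof (rule ccontr)
    assume "\<not> ?thesis"
    then have ne: "G \<noteq> {\<zero>\<^bsub>M\<^esub>}" "H \<noteq> {\<zero>\<^bsub>M\<^esub>}" by auto
    note D = decomposesD[OF GH]
    have "G \<in> direct_summands R M"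
      using decomposes_assoc'(1)[OF E(1) GH] mem_direct_summands by blast
    then have "G = E" using min D(5) ne(1) by blast
    moreover have "H \<in> direct_summands R M"
      using decomposes_assoc'(1)[OF E(1) decomposes_commute[OF GH]] mem_direct_summands by blast
    then have "H = E" using min D(6) ne(2) by blast
    ultimately show False using ne D(7) submoduleD(3)[OF D(1)] by blast
  qed
  then show ?thesis
    using E(2) decomposes_iff[OF decomposesD(1)[OF E(1)]] unfolding indecomposable_def by simp
qed

text \<open>
  The goal is to reach \<open>X = A\<close> by enlarging \<open>X\<close>, starting from \<open>X = 0\<close>, \<open>C = A'\<close>, \<open>D = B'\<close>. Since the chain
  condition is the descending one, the complement \<open>W = C \<oplus> D\<close> of \<open>X\<close> is made minimal instead. A minimal
  nonzero direct summand \<open>E\<close> of \<open>M\<close> inside \<open>Y = A \<inter> W\<close> is indecomposable and drives the next step.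
\<close>

lemma exchange:
  assumes "krull_schmidt_artinian R M"
    and AB: "decomposes (carrier M) A B" and AB': "decomposes (carrier M) A' B'"
    and strong: "\<forall>E\<in>direct_summands R M. E \<subseteq> A \<longrightarrow>
      indecomposable R (M\<lparr>carrier := E\<rparr>) \<longrightarrow> strongly_indecomposable R (M\<lparr>carrier := E\<rparr>)"
  obtains W C C' D D' where "decomposes (carrier M) A W" "decomposes W C D"
    "decomposes A' C C'" "decomposes B' D D'"
proof -
  define \<S> where "\<S> = {W. \<exists>X C C' D D'. X \<subseteq> A \<and> decomposes (carrier M) X W \<and> decomposes W C D \<and>
    decomposes A' C C' \<and> decomposes B' D D'}"
  note A = decomposesD[OF AB] and A' = decomposesD[OF AB']
  have "\<S> \<subseteq> direct_summands R M"
    unfolding \<S>_def using mem_direct_summands decomposes_commute by blast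
  moreover have "carrier M \<in> \<S>"
  proof -
    have "decomposes A' A' {\<zero>\<^bsub>M\<^esub>}" "decomposes B' B' {\<zero>\<^bsub>M\<^esub>}"
      using A'(1,2) decomposes_zero decomposes_commute by blast+
    then show ?thesis
      unfolding \<S>_def
      using decomposes_zero[OF submodule_carrier] AB' submoduleD(3)[OF A(1)] by blast
  qed
  ultimately obtain W where WS: "W \<in> \<S>" and min: "\<And>V. V \<in> \<S> \<Longrightarrow> V \<subseteq> W \<Longrightarrow> V = W"
    using krull_schmidt_artinian_minimal[OF assms(1), of \<S>] by blast
  from WS obtain X C C' D D' where X: "X \<subseteq> A" and XW: "decomposes (carrier M) X W"
    and CD: "decomposes W C D" and CC: "decomposes A' C C'" and DD: "decomposes B' D D'"
    unfolding \<S>_def by blast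
  have "X = A"
  proof (rule ccontr)
    assume "X \<noteq> A"
    note XW' = decomposes_commute[OF XW]
    define Y where "Y = A \<inter> W"
    have AXY: "decomposes A X Y"
      unfolding Y_def using decomposes_between[OF XW A(1) X A(5)] .
    note Y = decomposesD[OF AXY]
    have "Y \<noteq> {\<zero>\<^bsub>M\<^esub>}"
    proof
      assume "Y = {\<zero>\<^bsub>M\<^esub>}"
      then have "A = X <+>\<^bsub>M\<^esub> {\<zero>\<^bsub>M\<^esub>}" using Y(4) by simp
      also have "\<dots> = X" using decomposesD(4)[OF decomposes_commute[OF decomposes_zero[OF Y(1)]]] .
      finally show False using \<open>X \<noteq> A\<close> by simp
    qed
    define \<T> where "\<T> = {E \<in> direct_summands R M. E \<subseteq> Y \<and> E \<noteq> {\<zero>\<^bsub>M\<^esub>}}"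
    have "Y \<in> direct_summands R M"
      using decomposes_assoc'(1)[OF AB decomposes_commute[OF AXY]] mem_direct_summands by blast
    then have "\<T> \<noteq> {}" "\<T> \<subseteq> direct_summands R M"
      unfolding \<T>_def using \<open>Y \<noteq> {\<zero>\<^bsub>M\<^esub>}\<close> by blast+
    then obtain E where ET: "E \<in> \<T>" and Emin: "\<And>V. V \<in> \<T> \<Longrightarrow> V \<subseteq> E \<Longrightarrow> V = E"
      using krull_schmidt_artinian_minimal[OF assms(1), of \<T>] by blast
    then have EY: "E \<subseteq> Y" and E0: "E \<noteq> {\<zero>\<^bsub>M\<^esub>}" and ES: "E \<in> direct_summands R M"
      unfolding \<T>_def by auto
    then obtain F where EF: "decomposes (carrier M) E F" using mem_direct_summands by blast
    note E = decomposesD[OF EF]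
    have "indecomposable R (M\<lparr>carrier := E\<rparr>)"
      using indecomposable_minimal_summand[OF EF E0] Emin EY unfolding \<T>_def by blast
    then have SE: "strongly_indecomposable R (M\<lparr>carrier := E\<rparr>)"
      using strong ES EY Y(6) by blast
    have XE: "X <+>\<^bsub>M\<^esub> E \<subseteq> A"
      using X EY Y(6) by (intro sum_subset[OF A(1)]) auto
    \<comment> \<open>a complement \<open>K\<close> of \<open>E\<close> that contains \<open>X\<close>, so that the projection onto \<open>E\<close> along \<open>K\<close> kills \<open>X\<close>\<close>
    have "decomposes Y E (Y \<inter> F)"
      using decomposes_between[OF EF Y(2) EY] submoduleD(1)[OF Y(2)] by blast
    from decomposes_assoc'[OF decomposes_commute[OF AXY] this]
    have AE: "decomposes A E ((Y \<inter> F) <+>\<^bsub>M\<^esub> X)" and YX: "decomposes ((Y \<inter> F) <+>\<^bsub>M\<^esub> X) (Y \<inter> F) X" .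
    define K where "K = ((Y \<inter> F) <+>\<^bsub>M\<^esub> X) <+>\<^bsub>M\<^esub> B"
    have ME: "decomposes (carrier M) E K" and KX: "decomposes K ((Y \<inter> F) <+>\<^bsub>M\<^esub> X) B"
      unfolding K_def using decomposes_assoc'[OF AB AE] .
    define p where "p = component E K"
    have p: "p \<in> lmod_hom R M (M\<lparr>carrier := E\<rparr>)"
      unfolding p_def using component_hom[OF ME] by simp
    have pX: "p x = \<zero>\<^bsub>M\<^esub>" if "x \<in> X" for x
    proof -
      have "x \<in> K" using that decomposesD(6)[OF YX] decomposesD(5)[OF KX] by blast
      then show ?thesis unfolding p_def by (rule component_right[OF ME])
    qed
    have pE: "p e = e" if "e \<in> E" for e
      unfolding p_def by (rule component_left[OF ME that])
    \<comment> \<open>the two summands of the identity of \<open>E\<close>, through \<open>C\<close> and through \<open>D\<close>\<close>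
    define u where "u e = p (component C D (component W X e))" for e
    define v where "v e = p (component D C (component W X e))" for e
    have MW: "component W X \<in> lmod_hom R M (M\<lparr>carrier := W\<rparr>)"
      using component_hom[OF XW'] by simp
    have comp: "(\<lambda>e. p (component C D (component W X e))) \<in>
        lmod_hom R (M\<lparr>carrier := E\<rparr>) (M\<lparr>carrier := E\<rparr>)"
      if "decomposes W C D" for C D
    proof -
      have "component C D \<in> lmod_hom R (M\<lparr>carrier := W\<rparr>) M"
        using lmod_hom_extend_codomain[OF component_hom[OF that], of "carrier M"]
          submoduleD(1)[OF decomposesD(1)[OF that]] by simp
      from lmod_hom_comp[OF lmod_hom_comp[OF MW this] p] show ?thesis
        using lmod_hom_restrict_domain[where U = "carrier M" and M = M] submoduleD(1)[OF E(1)] by simp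
    qed
    have u: "u \<in> lmod_hom R (M\<lparr>carrier := E\<rparr>) (M\<lparr>carrier := E\<rparr>)"
      unfolding u_def by (rule comp[OF CD])
    have v: "v \<in> lmod_hom R (M\<lparr>carrier := E\<rparr>) (M\<lparr>carrier := E\<rparr>)"
      unfolding v_def by (rule comp[OF decomposes_commute[OF CD]])
    have uv: "u e \<oplus>\<^bsub>M\<^esub> v e = e" if e: "e \<in> E" for e
    proof -
      have eM: "e \<in> carrier M" using e E(5) by blast
      let ?x = "component X W e" and ?w = "component W X e"
      have x: "?x \<in> X" and w: "?w \<in> W" and xw: "?x \<oplus>\<^bsub>M\<^esub> ?w = e"
        using component_in[OF XW eM] component_in[OF XW' eM] component_sum[OF XW eM] by auto
      let ?c = "component C D ?w" and ?d = "component D C ?w"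
      have c: "?c \<in> C" and d: "?d \<in> D" and cd: "?c \<oplus>\<^bsub>M\<^esub> ?d = ?w"
        using component_in[OF CD w] component_in[OF decomposes_commute[OF CD] w]
          component_sum[OF CD w] by auto
      have carr: "?x \<in> carrier M" "?w \<in> carrier M" "?c \<in> carrier M" "?d \<in> carrier M"
        using x w c d decomposesD(1,2)[OF XW] decomposesD(1,2)[OF CD] submoduleD(2) by blast+
      have pin: "p ?w \<in> carrier M" using lmod_homD(1)[OF p carr(2)] E(5) by auto
      have "e = p (?x \<oplus>\<^bsub>M\<^esub> ?w)" unfolding xw using pE[OF e] by simp
      also have "\<dots> = p ?x \<oplus>\<^bsub>M\<^esub> p ?w" using lmod_homD(2)[OF p carr(1,2)] by simp
      also have "\<dots> = p ?w" using pX[OF x] pin by simp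
      also have "\<dots> = p (?c \<oplus>\<^bsub>M\<^esub> ?d)" unfolding cd ..
      also have "\<dots> = u e \<oplus>\<^bsub>M\<^esub> v e" unfolding u_def v_def using lmod_homD(2)[OF p carr(3,4)] by simp
      finally show ?thesis by simp
    qed
    interpret E: left_module R "M\<lparr>carrier := E\<rparr>" by (rule left_module_submodule[OF E(1)])
    obtain c where c: "c \<in> lmod_hom R (M\<lparr>carrier := E\<rparr>) (M\<lparr>carrier := E\<rparr>)"
      and cuv: "(\<forall>e\<in>E. c (u e) = e) \<or> (\<forall>e\<in>E. c (v e) = e)"
      using E.strongly_indecomposable_left_inverse[OF SE u v] uv by auto
    define g where "g x = c (p x)" for x
    have g: "g \<in> lmod_hom R M (M\<lparr>carrier := E\<rparr>)"
      unfolding g_def by (rule lmod_hom_comp[OF p c])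
    have shrink: False if "V \<in> \<S>" "V \<subset> W" for V using min that by blast
    from cuv show False
    proof
      assume "\<forall>e\<in>E. c (u e) = e"
      then have "\<forall>e\<in>E. g (component C D (component W X e)) = e"
        unfolding g_def u_def by simp
      from exchange_step[OF XW CD E(1) E0 g this]
      obtain C\<^sub>1 C\<^sub>2 V where *: "decomposes C C\<^sub>1 C\<^sub>2" "decomposes V C\<^sub>2 D" "V \<subset> W"
        "decomposes (carrier M) (X <+>\<^bsub>M\<^esub> E) V" by metis
      have "decomposes A' C\<^sub>2 (C\<^sub>1 <+>\<^bsub>M\<^esub> C')"
        using decomposes_assoc'(1)[OF CC decomposes_commute[OF *(1)]] .
      then have "V \<in> \<S>" unfolding \<S>_def using * XE DD by blast
      then show False using shrink *(3) by blast
    next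
      assume "\<forall>e\<in>E. c (v e) = e"
      then have "\<forall>e\<in>E. g (component D C (component W X e)) = e"
        unfolding g_def v_def by simp
      from exchange_step[OF XW decomposes_commute[OF CD] E(1) E0 g this]
      obtain D\<^sub>1 D\<^sub>2 V where *: "decomposes D D\<^sub>1 D\<^sub>2" "decomposes V D\<^sub>2 C" "V \<subset> W"
        "decomposes (carrier M) (X <+>\<^bsub>M\<^esub> E) V" by metis
      have "decomposes B' D\<^sub>2 (D\<^sub>1 <+>\<^bsub>M\<^esub> D')"
        using decomposes_assoc'(1)[OF DD decomposes_commute[OF *(1)]] .
      then have "V \<in> \<S>" unfolding \<S>_def using * XE CC decomposes_commute by blast
      then show False using shrink *(3) by blast
    qed
  qed
  then show thesis using that XW CD CC DD by blast
qed

end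

section \<open>Decompositions relative to a class of modules\<close>

locale summand_closed_class = left_module R M
  for R :: "('r, 'c) ring_scheme" (structure) and M :: "('r, 'a) module" (structure) +
  fixes \<Omega> :: "('r, 'a) module set"
  assumes sums_closed: "closed_under_finite_direct_sums R \<Omega>"
    and summands_closed: "closed_under_direct_summands R \<Omega>"
begin

abbreviation in_class :: "'a set \<Rightarrow> bool"
  where "in_class U \<equiv> M\<lparr>carrier := U\<rparr> \<in> \<Omega>"

text \<open>
  Closure under finite direct sums is formulated with external direct sums, whose elements are
  functions. A family of coordinate homomorphisms that is jointly bijective is an isomorphism to the
  external direct sum, and it is easier to supply. The three lemmas that follow are the cases of zero,
  one and two coordinates; with one coordinate this gives closure under isomorphism.
\<close>

lemma in_class_coordinates:
  fixes k :: nat and N :: "nat \<Rightarrow> ('r, 'a) module" and f :: "nat \<Rightarrow> 'a \<Rightarrow> 'a"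
  assumes "submodule U R M" "\<And>i. i < k \<Longrightarrow> N i \<in> \<Omega>"
    and hom: "\<And>i. i < k \<Longrightarrow> f i \<in> lmod_hom R (M\<lparr>carrier := U\<rparr>) (N i)"
    and inj: "\<And>x y. x \<in> U \<Longrightarrow> y \<in> U \<Longrightarrow> (\<And>i. i < k \<Longrightarrow> f i x = f i y) \<Longrightarrow> x = y"
    and surj: "\<And>z. (\<And>i. i < k \<Longrightarrow> z i \<in> carrier (N i)) \<Longrightarrow> \<exists>x\<in>U. \<forall>i<k. f i x = z i"
  shows "in_class U"
proof -
  let ?P = "external_direct_sum k N" and ?f = "\<lambda>x. \<lambda>i\<in>{..<k}. f i x"
  note f = lmod_homD[OF hom, simplified]
  have "?f \<in> lmod_hom R (M\<lparr>carrier := U\<rparr>) ?P"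
    using f by (intro lmod_homI) (auto simp: external_direct_sum_def fun_eq_iff)
  moreover have "bij_betw ?f U (carrier ?P)"
    unfolding bij_betw_def
  proof
    show "inj_on ?f U"
    proof (rule inj_onI)
      fix x y assume xy: "x \<in> U" "y \<in> U" "?f x = ?f y"
      have "f i x = f i y" if "i < k" for i using fun_cong[OF xy(3), of i] that by simp
      then show "x = y" using inj xy(1,2) by blast
    qed
    show "?f ` U = carrier ?P"
    proof
      show "?f ` U \<subseteq> carrier ?P" using f(1) by (simp add: external_direct_sum_def image_subset_iff restrict_PiE_iff)
      show "carrier ?P \<subseteq> ?f ` U"
      proof
        fix z assume "z \<in> carrier ?P"
        then have z: "z \<in> (\<Pi>\<^sub>E i\<in>{..<k}. carrier (N i))" by (simp add: external_direct_sum_def)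
        then obtain x where x: "x \<in> U" "\<forall>i<k. f i x = z i" using surj[of z] by auto
        have "z i = ?f x i" for i
          using x(2) PiE_arb[OF z, of i] by (cases "i < k") auto
        then have "z = ?f x" by blast
        then show "z \<in> ?f ` U" using x(1) by blast
      qed
    qed
  qed
  ultimately have "lmod_isomorphic R (M\<lparr>carrier := U\<rparr>) ?P"
    unfolding lmod_isomorphic_def by auto
  then show ?thesis
    using sums_closed left_module_submodule[OF assms(1)] assms(2)
    unfolding closed_under_finite_direct_sums_def by blast
qed

lemma in_class_zero: "in_class {\<zero>\<^bsub>M\<^esub>}"
  by (rule in_class_coordinates[OF submodule_zero, of 0]) auto

lemma in_class_isomorphic:
  assumes "submodule U R M" "N \<in> \<Omega>" "lmod_isomorphic R (M\<lparr>carrier := U\<rparr>) N"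
  shows "in_class U"
proof -
  obtain f where f: "f \<in> lmod_hom R (M\<lparr>carrier := U\<rparr>) N" "bij_betw f U (carrier N)"
    using assms(3) unfolding lmod_isomorphic_def by auto
  show ?thesis
  proof (rule in_class_coordinates[OF assms(1), of 1 "\<lambda>_. N" "\<lambda>_. f"])
    show "x = y" if "x \<in> U" "y \<in> U" "\<And>i::nat. i < 1 \<Longrightarrow> f x = f y" for x y
      using f(2) that(1,2) that(3)[of 0] unfolding bij_betw_def inj_on_def by simp
    show "\<exists>x\<in>U. \<forall>i<1. f x = z i" if "\<And>i. i < 1 \<Longrightarrow> z i \<in> carrier N" for z :: "nat \<Rightarrow> 'a"
    proof -
      have "z 0 \<in> f ` U" using f(2) that[of 0] unfolding bij_betw_def by simp
      then show ?thesis by force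
    qed
  qed (use f assms in auto)
qed

lemma in_class_sum:
  assumes "decomposes U A B" "in_class A" "in_class B"
  shows "in_class U"
proof (rule in_class_coordinates[of _ 2 "case_nat (M\<lparr>carrier := A\<rparr>) (\<lambda>_. M\<lparr>carrier := B\<rparr>)"
      "case_nat (component A B) (\<lambda>_. component B A)"])
  note D = decomposesD[OF assms(1)]
  note BA = decomposes_commute[OF assms(1)]
  let ?N = "case_nat (M\<lparr>carrier := A\<rparr>) (\<lambda>_. M\<lparr>carrier := B\<rparr>)"
  let ?f = "case_nat (component A B) (\<lambda>_. component B A)"
  show "submodule U R M" by (rule D)
  show "?N i \<in> \<Omega>" if "i < 2" for i using assms(2,3) by (simp split: nat.split)
  show "?f i \<in> lmod_hom R (M\<lparr>carrier := U\<rparr>) (?N i)" if "i < 2" for i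
    using component_hom[OF assms(1)] component_hom[OF BA] by (simp split: nat.split)
  show "x = y" if "x \<in> U" "y \<in> U" "\<And>i. i < 2 \<Longrightarrow> ?f i x = ?f i y" for x y
  proof -
    have "component A B x = component A B y" using that(3)[of 0] by simp
    moreover have "component B A x = component B A y" using that(3)[of 1] by simp
    ultimately show ?thesis
      using component_sum[OF assms(1) that(1)] component_sum[OF assms(1) that(2)] by metis
  qed
  show "\<exists>x\<in>U. \<forall>i<2. ?f i x = z i" if "\<And>i. i < 2 \<Longrightarrow> z i \<in> carrier (?N i)" for z
  proof
    have z: "z 0 \<in> A" "z 1 \<in> B" using that[of 0] that[of 1] by auto
    have c: "z 0 \<in> carrier M" "z 1 \<in> carrier M" using z D(1,2) submoduleD(2) by blast+
    show "z 0 \<oplus>\<^bsub>M\<^esub> z 1 \<in> U" using z D(3,5,6) submoduleD(5) by blast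
    have "component A B (z 0 \<oplus>\<^bsub>M\<^esub> z 1) = z 0" by (rule component_add[OF assms(1) z])
    moreover have "component B A (z 1 \<oplus>\<^bsub>M\<^esub> z 0) = z 1" by (rule component_add[OF BA z(2,1)])
    then have "component B A (z 0 \<oplus>\<^bsub>M\<^esub> z 1) = z 1" using M.a_comm[OF c] by simp
    ultimately show "\<forall>i<2. ?f i (z 0 \<oplus>\<^bsub>M\<^esub> z 1) = z i" by (auto simp: less_2_cases_iff)
  qed
qed

lemma in_class_summand:
  assumes "decomposes U A B" "in_class U"
  shows "in_class A"
proof -
  have "A \<in> direct_summands R (M\<lparr>carrier := U\<rparr>)"
    using decomposes_iff[OF decomposesD(3)[OF assms(1)]] assms(1)
    unfolding direct_summands_def by blast
  from bspec[OF bspec[OF summands_closed[unfolded closed_under_direct_summands_def] assms(2)] this]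
  show ?thesis by simp
qed

definition free_of_class :: "'a set \<Rightarrow> bool"
  where "free_of_class B \<longleftrightarrow> (\<forall>C C'. decomposes B C C' \<longrightarrow> in_class C \<longrightarrow> C = {\<zero>\<^bsub>M\<^esub>})"

lemma class_decomposition_iff:
  "class_decomposition R \<Omega> M A B \<longleftrightarrow>
    decomposes (carrier M) A B \<and> in_class A \<and> free_of_class B"
proof -
  have "direct_summands R (M\<lparr>carrier := B\<rparr>) = {C. \<exists>C'. decomposes B C C'}"
    if "decomposes (carrier M) A B"
    unfolding direct_summands_def decomposes_iff[OF decomposesD(2)[OF that]] ..
  then show ?thesis
    unfolding class_decomposition_def free_of_class_def decomposes_carrier_iff[symmetric] by auto
qed

text \<open>Direct summands are pulled back along the isomorphism, so that its inverse does not occur.\<close>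

lemma free_of_class_isomorphic:
  assumes "free_of_class B" "submodule B R M" "decomposes V C D" "in_class C"
    and "lmod_isomorphic R (M\<lparr>carrier := B\<rparr>) (M\<lparr>carrier := V\<rparr>)"
  shows "C = {\<zero>\<^bsub>M\<^esub>}"
proof -
  note V = decomposesD[OF assms(3)]
  obtain f where f: "f \<in> lmod_hom R (M\<lparr>carrier := B\<rparr>) (M\<lparr>carrier := V\<rparr>)" and bij: "bij_betw f B V"
    using assms(5) unfolding lmod_isomorphic_def by auto
  have inj: "inj_on f B" and img: "f ` B = V" using bij by (auto simp: bij_betw_def)
  note fD = lmod_homD[OF f, simplified]
  have zero: "f \<zero>\<^bsub>M\<^esub> = \<zero>\<^bsub>M\<^esub>"
    using lmod_hom_zero[OF left_module_submodule left_module_submodule f] assms(2) V(3) by simp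
  define C' D' where "C' = {b \<in> B. f b \<in> C}" and "D' = {b \<in> B. f b \<in> D}"
  have fC: "f ` C' = C" unfolding C'_def using img V(5) by blast
  have BCD: "decomposes B C' D'"
  proof (rule decomposesI)
    show C': "submodule C' R M" and D': "submodule D' R M"
      unfolding C'_def D'_def by (intro submodule_preimage[OF assms(2) V(3) f] V(1,2))+
    show "x = \<zero>\<^bsub>M\<^esub>" if "x \<in> C'" "x \<in> D'" for x
    proof -
      have "x \<in> B" "f x = \<zero>\<^bsub>M\<^esub>" using that V(7) unfolding C'_def D'_def by blast+
      then show ?thesis
        using inj zero submoduleD(3)[OF assms(2)] by (metis inj_onD)
    qed
    show "C' <+>\<^bsub>M\<^esub> D' = B"
    proof
      show "C' <+>\<^bsub>M\<^esub> D' \<subseteq> B" unfolding C'_def D'_def by (intro sum_subset[OF assms(2)]) auto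
      show "B \<subseteq> C' <+>\<^bsub>M\<^esub> D'"
      proof
        fix b assume b: "b \<in> B"
        then have "f b \<in> C <+>\<^bsub>M\<^esub> D" using fD(1) V(4) by simp
        then obtain x y where xy: "x \<in> C" "y \<in> D" "f b = x \<oplus>\<^bsub>M\<^esub> y" using mem_sum by blast
        have "x \<in> f ` B" "y \<in> f ` B" using xy(1,2) V(5,6) img by blast+
        then obtain x' y' where x': "x' \<in> B" "f x' = x" and y': "y' \<in> B" "f y' = y" by force
        have "f (x' \<oplus>\<^bsub>M\<^esub> y') = f b" using fD(2)[OF x'(1) y'(1)] x'(2) y'(2) xy(3) by simp
        then have "x' \<oplus>\<^bsub>M\<^esub> y' = b"
          using inj_onD[OF inj] b submoduleD(5)[OF assms(2) x'(1) y'(1)] by blast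
        moreover have "x' \<in> C'" "y' \<in> D'" unfolding C'_def D'_def using x' y' xy by auto
        ultimately show "b \<in> C' <+>\<^bsub>M\<^esub> D'" using mem_sum by blast
      qed
    qed
  qed
  have "lmod_isomorphic R (M\<lparr>carrier := C'\<rparr>) (M\<lparr>carrier := C\<rparr>)"
  proof -
    have "f \<in> lmod_hom R (M\<lparr>carrier := C'\<rparr>) (M\<lparr>carrier := C\<rparr>)"
      using fD unfolding C'_def by (intro lmod_homI) auto
    moreover have "bij_betw f C' C"
      unfolding bij_betw_def using fC inj inj_on_subset decomposesD(5)[OF BCD] by blast
    ultimately show ?thesis unfolding lmod_isomorphic_def by auto
  qed
  then have "in_class C'" using in_class_isomorphic[OF decomposesD(1)[OF BCD] assms(4)] by blast
  then have "C' = {\<zero>\<^bsub>M\<^esub>}" using assms(1) BCD unfolding free_of_class_def by blast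
  then show ?thesis using fC zero by simp
qed

lemma exists_class_decomposition:
  assumes "krull_schmidt_artinian R M"
  shows "\<exists>A B. class_decomposition R \<Omega> M A B"
proof -
  define \<S> where "\<S> = {B. \<exists>A. decomposes (carrier M) A B \<and> in_class A}"
  have "\<S> \<subseteq> direct_summands R M"
    unfolding \<S>_def using mem_direct_summands decomposes_commute by blast
  moreover have "carrier M \<in> \<S>"
    unfolding \<S>_def using decomposes_zero[OF submodule_carrier] in_class_zero by blast
  ultimately obtain B where "B \<in> \<S>" and min: "\<And>V. V \<in> \<S> \<Longrightarrow> V \<subseteq> B \<Longrightarrow> V = B"
    using krull_schmidt_artinian_minimal[OF assms, of \<S>] by blast
  then obtain A where AB: "decomposes (carrier M) A B" and A: "in_class A" unfolding \<S>_def by blast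
  have "C = {\<zero>\<^bsub>M\<^esub>}" if CD: "decomposes B C D" and C: "in_class C" for C D
  proof -
    note AC = decomposes_assoc[OF AB CD]
    have "D \<in> \<S>" unfolding \<S>_def using AC(1) in_class_sum[OF AC(2) A C] by blast
    then have "D = B" using min decomposesD(6)[OF CD] by blast
    then show ?thesis
      using decomposesD(5,7)[OF CD] submoduleD(3)[OF decomposesD(1)[OF CD]] by blast
  qed
  then show ?thesis
    using AB A unfolding class_decomposition_iff free_of_class_def by blast
qed

lemma class_decomposition_unique:
  assumes "krull_schmidt_artinian R M"
    and strong: "\<forall>N \<in> \<Omega>. indecomposable R N \<longrightarrow> strongly_indecomposable R N"
    and dec: "class_decomposition R \<Omega> M A B" and dec': "class_decomposition R \<Omega> M A' B'"
  shows "lmod_isomorphic R (M\<lparr>carrier := A\<rparr>) (M\<lparr>carrier := A'\<rparr>)"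
    and "lmod_isomorphic R (M\<lparr>carrier := B\<rparr>) (M\<lparr>carrier := B'\<rparr>)"
proof -
  have AB: "decomposes (carrier M) A B" and A: "in_class A" and B: "free_of_class B"
    using dec unfolding class_decomposition_iff by auto
  have AB': "decomposes (carrier M) A' B'" and A': "in_class A'" and B': "free_of_class B'"
    using dec' unfolding class_decomposition_iff by auto
  have strongE: "\<forall>E\<in>direct_summands R M. E \<subseteq> A \<longrightarrow>
    indecomposable R (M\<lparr>carrier := E\<rparr>) \<longrightarrow> strongly_indecomposable R (M\<lparr>carrier := E\<rparr>)"
  proof (intro ballI impI)
    fix E assume E: "E \<in> direct_summands R M" "E \<subseteq> A" "indecomposable R (M\<lparr>carrier := E\<rparr>)"
    obtain F where "decomposes (carrier M) E F" using E(1) mem_direct_summands by blast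
    then have "decomposes A E (A \<inter> F)"
      using decomposes_between[of _ E F A] decomposesD(1,5)[OF AB] E(2) by blast
    then have "in_class E" using A by (rule in_class_summand)
    then show "strongly_indecomposable R (M\<lparr>carrier := E\<rparr>)" using strong E(3) by blast
  qed
  obtain W C C' D D' where AW: "decomposes (carrier M) A W" and CD: "decomposes W C D"
    and CC: "decomposes A' C C'" and DD: "decomposes B' D D'"
    using exchange[OF assms(1) AB AB' strongE] by metis
  \<comment> \<open>regrouping \<open>M = A' \<oplus> B'\<close> as \<open>(D' \<oplus> C') \<oplus> (C \<oplus> D)\<close>\<close>
  have M1: "decomposes (carrier M) (B' <+>\<^bsub>M\<^esub> C') C" and BC: "decomposes (B' <+>\<^bsub>M\<^esub> C') B' C'"
    using decomposes_assoc[OF decomposes_commute[OF AB'] decomposes_commute[OF CC]] .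
  have BC': "decomposes (B' <+>\<^bsub>M\<^esub> C') D (D' <+>\<^bsub>M\<^esub> C')" "decomposes (D' <+>\<^bsub>M\<^esub> C') D' C'"
    using decomposes_assoc'[OF BC DD] .
  have "decomposes (carrier M) (C <+>\<^bsub>M\<^esub> D) (D' <+>\<^bsub>M\<^esub> C')"
    using decomposes_assoc(1)[OF decomposes_commute[OF M1] BC'(1)] .
  then have "decomposes (carrier M) (D' <+>\<^bsub>M\<^esub> C') W"
    unfolding decomposesD(4)[OF CD] by (rule decomposes_commute)
  then have "in_class (D' <+>\<^bsub>M\<^esub> C')"
    using in_class_isomorphic[OF _ A complement_isomorphic[OF _ AW]] decomposesD(1) by blast
  then have "in_class D'" using in_class_summand[OF BC'(2)] by blast
  then have "D' = {\<zero>\<^bsub>M\<^esub>}"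
    using B' decomposes_commute[OF DD] unfolding free_of_class_def by blast
  then have "B' = D"
    using decomposesD(4)[OF DD]
      decomposesD(4)[OF decomposes_commute[OF decomposes_zero[OF decomposesD(1)[OF DD]]]] by simp
  have "C = {\<zero>\<^bsub>M\<^esub>}"
    using free_of_class_isomorphic[OF B decomposesD(2)[OF AB] CD in_class_summand[OF CC A']]
      complement_isomorphic[OF decomposes_commute[OF AB] decomposes_commute[OF AW]] by blast
  then have "W = B'"
    using decomposesD(4)[OF CD] decomposesD(4)[OF decomposes_zero[OF decomposesD(2)[OF CD]]] \<open>B' = D\<close>
    by simp
  then have AB'': "decomposes (carrier M) A B'" using AW by simp
  \<comment> \<open>\<open>A\<close> and \<open>A'\<close> are complements of \<open>B'\<close>, while \<open>B\<close> and \<open>B'\<close> are complements of \<open>A\<close>\<close>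
  show "lmod_isomorphic R (M\<lparr>carrier := A\<rparr>) (M\<lparr>carrier := A'\<rparr>)"
    by (rule complement_isomorphic[OF AB'' AB'])
  show "lmod_isomorphic R (M\<lparr>carrier := B\<rparr>) (M\<lparr>carrier := B'\<rparr>)"
    by (rule complement_isomorphic[OF AB[THEN decomposes_commute] AB''[THEN decomposes_commute]])
qed

end

theorem theorem3p6:
  fixes R :: "('r, 'c) ring_scheme"
    and \<Omega> :: "('r, 'a) module set"
    and M :: "('r, 'a) module"
  assumes "ring R"
    and "\<forall>N \<in> \<Omega>. left_module R N"
    and "closed_under_finite_direct_sums R \<Omega>"
    and "closed_under_direct_summands R \<Omega>"
    and "\<forall>N \<in> \<Omega>. indecomposable R N \<longrightarrow> strongly_indecomposable R N"
    and "left_module R M"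
    and "krull_schmidt_artinian R M"
  shows "\<exists>A B. class_decomposition R \<Omega> M A B \<and>
    (\<forall>A' B'. class_decomposition R \<Omega> M A' B' \<longrightarrow>
       decomposition_isomorphic R
         (UNIV :: bool set) (case_bool (M\<lparr>carrier := A\<rparr>) (M\<lparr>carrier := B\<rparr>))
         (UNIV :: bool set) (case_bool (M\<lparr>carrier := A'\<rparr>) (M\<lparr>carrier := B'\<rparr>)))"
proof -
  interpret summand_closed_class R M \<Omega>
    using assms by (intro summand_closed_class.intro summand_closed_class_axioms.intro)
  obtain A B where AB: "class_decomposition R \<Omega> M A B"
    using exists_class_decomposition[OF assms(7)] by blast
  have "decomposition_isomorphic R
      (UNIV :: bool set) (case_bool (M\<lparr>carrier := A\<rparr>) (M\<lparr>carrier := B\<rparr>))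
      (UNIV :: bool set) (case_bool (M\<lparr>carrier := A'\<rparr>) (M\<lparr>carrier := B'\<rparr>))"
    if "class_decomposition R \<Omega> M A' B'" for A' B'
    using class_decomposition_unique[OF assms(7,5) AB that]
    unfolding decomposition_isomorphic_def
    by (intro exI[of _ id]) (auto split: bool.split)
  then show ?thesis using AB by blast
qed

end
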